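(* Let $X$ be a Tychonoff space. If $C_p(X)$ is a $k_{\mathbb{R}}$-space, then $X$ has the property $(\kappa)$, $X$ is universal $\kappa$-measure zero, and $X$ is a $\kappa$-space whose compact subsets are scattered.
   Context: All spaces are Tychonoff. $C_p(X)$ is the space of continuous real-valued functions on $X$ with the topology of pointwise convergence, and $C_p(X,[-1,1])$ is its subspace of functions with values in $[-1,1]$. A function $f:Z\to\mathbb{R}$ is $k$-continuous if its restriction to every compact subset of $Z$ is continuous. A space $Z$ is a $k_{\mathbb{R}}$-space if every $k$-continuous function $f:Z\to\mathbb{R}$ is continuous. Property $(\kappa)$: every pairwise disjoint sequence of finite subsets of $X$ has a strongly point-finite subsequence, where a family $\{A_i\}_{i\in I}$ of subsets of $X$ is strongly point-finite if there are open sets $U_i\supseteq A_i$ such that for every $x\in X$ the set $\{i\in I:x\in U_i\}$ is finite. $X$ is a $\kappa$-space if it is homeomorphic to a closed subspace of $C_p(Y)$ for some $k_{\mathbb{R}}$-space $Y$. Let $\beta X$ be the Stone–Čech compactification and $P(\beta X)$ the set of regular Borel probability measures on $\beta X$. A measure $\mu\in P(\beta X)$ acts on $f\in C_p(X,[-1,1])$ by $\mu(f)=\int_{\beta X}\beta f\,d\mu$, where $\beta f$ is the continuous extension of $f$. Put $P_d(X)=\{\mu\in P(\beta X):\mu(A)=1\text{ for some countable }A\subseteq X\}$ and $P_\kappa(X)=\{\mu\in P(\beta X):\mu\text{ is }k\text{-continuous on }C_p(X,[-1,1])\}$. $X$ is universal $\kappa$-measure zero if $P_\kappa(X)=P_d(X)$.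 *)

theory Defs
  imports "HOL-Analysis.Analysis"
begin

section \<open>Tychonoff spaces, function spaces, \<open>k\<^sub>R\<close>-spaces\<close>

definition tychonoff_space :: "'a topology \<Rightarrow> bool" where
  "tychonoff_space X \<longleftrightarrow> completely_regular_space X \<and> Hausdorff_space X"

text \<open>A continuous function on \<open>X\<close> is represented by the HOL function that is \<open>undefined\<close> outside
  \<open>topspace X\<close>, so that points of \<open>Cp X\<close> correspond to functions on \<open>topspace X\<close>.\<close>

definition Cp :: "'a topology \<Rightarrow> ('a \<Rightarrow> real) topology" where
  "Cp X = subtopology (product_topology (\<lambda>_. euclideanreal) (topspace X))
            {f. continuous_map X euclideanreal f}"

definition Cp_unit :: "'a topology \<Rightarrow> ('a \<Rightarrow> real) topology" where
  "Cp_unit X = subtopology (Cp X) {f. f ` topspace X \<subseteq> {-1..1}}"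

definition k_continuous :: "'a topology \<Rightarrow> ('a \<Rightarrow> real) \<Rightarrow> bool" where
  "k_continuous Z f \<longleftrightarrow>
     (\<forall>K. compactin Z K \<longrightarrow> continuous_map (subtopology Z K) euclideanreal f)"

definition kR_space :: "'a topology \<Rightarrow> bool" where
  "kR_space Z \<longleftrightarrow> (\<forall>f. k_continuous Z f \<longrightarrow> continuous_map Z euclideanreal f)"

lemma topspace_Cp:
  "topspace (Cp X) = extensional (topspace X) \<inter> {f. continuous_map X euclideanreal f}"
  by (auto simp: Cp_def PiE_def)

lemma topspace_Cp_unit:
  "topspace (Cp_unit X) = topspace (Cp X) \<inter> {f. f ` topspace X \<subseteq> {-1..1}}"
  by (simp add: Cp_unit_def)

section \<open>Scattered spaces and property \<open>(\<kappa>)\<close>\<close>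

definition scattered_space :: "'a topology \<Rightarrow> bool" where
  "scattered_space X \<longleftrightarrow>
     (\<forall>S. S \<subseteq> topspace X \<and> S \<noteq> {} \<longrightarrow> (\<exists>x\<in>S. \<exists>U. openin X U \<and> U \<inter> S = {x}))"

definition strongly_point_finite :: "'a topology \<Rightarrow> 'i set \<Rightarrow> ('i \<Rightarrow> 'a set) \<Rightarrow> bool" where
  "strongly_point_finite X I A \<longleftrightarrow>
     (\<exists>U. (\<forall>i\<in>I. openin X (U i) \<and> A i \<subseteq> U i) \<and>
          (\<forall>x\<in>topspace X. finite {i \<in> I. x \<in> U i}))"

definition property_kappa :: "'a topology \<Rightarrow> bool" where
  "property_kappa X \<longleftrightarrow>
     (\<forall>A :: nat \<Rightarrow> 'a set.
        (\<forall>n. finite (A n) \<and> A n \<subseteq> topspace X) \<and> disjoint_family A \<longrightarrow>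
        (\<exists>r :: nat \<Rightarrow> nat. strict_mono r \<and> strongly_point_finite X UNIV (A \<circ> r)))"

section \<open>\<open>\<kappa>\<close>-spaces\<close>

definition kappa_space_via :: "'b topology \<Rightarrow> 'a topology \<Rightarrow> bool" where
  "kappa_space_via Y X \<longleftrightarrow>
     tychonoff_space Y \<and> kR_space Y \<and>
     (\<exists>F. closedin (Cp Y) F \<and> X homeomorphic_space subtopology (Cp Y) F)"

text \<open>HOL cannot quantify over the type of points of \<open>Y\<close>.  The type used here loses no
  generality: a witness over any type yields one over \<open>'a \<Rightarrow> real\<close>, see \<open>kappa_spaceI\<close> below.\<close>

definition kappa_space :: "'a topology \<Rightarrow> bool" where
  "kappa_space X \<longleftrightarrow> (\<exists>Y :: ('a \<Rightarrow> real) topology. kappa_space_via Y X)"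

lemma kappa_spaceI:
  fixes X :: "'a topology" and Y :: "'b topology"
  assumes "kappa_space_via Y X"
  shows "kappa_space X"
proof -
  from assms obtain F where kR: "kR_space Y" and F: "closedin (Cp Y) F"
    and hom: "X homeomorphic_space subtopology (Cp Y) F"
    by (auto simp: kappa_space_via_def)
  then obtain h h' where hh: "homeomorphic_maps X (subtopology (Cp Y) F) h h'"
    by (auto simp: homeomorphic_space_def)
  have FC: "F \<subseteq> topspace (Cp Y)" using F by (rule closedin_subset)
  have ch: "continuous_map X (subtopology (Cp Y) F) h"
    and ch': "continuous_map (subtopology (Cp Y) F) X h'"
    and h'h: "\<And>x. x \<in> topspace X \<Longrightarrow> h' (h x) = x"
    and hh': "\<And>f. f \<in> F \<Longrightarrow> h (h' f) = f"
    using hh FC by (auto simp: homeomorphic_maps_def)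
  have hF: "h x \<in> F" if "x \<in> topspace X" for x
    using continuous_map_image_subset_topspace[OF ch] that by auto
  have h'X: "h' f \<in> topspace X" if "f \<in> F" for f
    using continuous_map_image_subset_topspace[OF ch'] that FC by auto
  have hC: "continuous_map Y euclideanreal (h x)" "h x \<in> extensional (topspace Y)"
    if "x \<in> topspace X" for x
    using hF[OF that] FC by (auto simp: topspace_Cp)
  have ev: "continuous_map (Cp Y) euclideanreal (\<lambda>f. f y)" if "y \<in> topspace Y" for y
    unfolding Cp_def using that
    by (intro continuous_map_from_subtopology continuous_map_product_projection)

  define p where "p y = (\<lambda>x\<in>topspace X. h x y)" for y
  define P where "P = p ` topspace Y"
  define G where "G = {g :: ('a \<Rightarrow> real) \<Rightarrow> real. continuous_map Y euclideanreal (g \<circ> p)}"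
  define e where "e z = (\<lambda>g\<in>G. g z)" for z
  define R where "R = product_topology (\<lambda>_. euclideanreal) G"
  define Z where "Z = pullback_topology P e R"
  have eR: "e z \<in> topspace R" for z by (auto simp: R_def e_def)
  have topZ: "topspace Z = P" using eR by (auto simp: Z_def topspace_pullback_topology)
  have ce: "continuous_map Z R e"
    using continuous_map_pullback[OF continuous_map_id, of P e R] by (simp add: Z_def)
  have cp: "continuous_map Y Z p"
    unfolding Z_def
  proof (rule continuous_map_pullback')
    show "continuous_map Y R (e \<circ> p)"
      by (auto simp: R_def e_def continuous_map_componentwise G_def o_def)
    show "topspace Y \<subseteq> p -` P" by (auto simp: P_def)
  qed
  have contZ: "continuous_map Z euclideanreal g \<longleftrightarrow> continuous_map Y euclideanreal (g \<circ> p)" for g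
  proof
    assume "continuous_map Z euclideanreal g"
    then show "continuous_map Y euclideanreal (g \<circ> p)"
      using cp continuous_map_compose by blast
  next
    assume "continuous_map Y euclideanreal (g \<circ> p)"
    then have g: "g \<in> G" by (simp add: G_def)
    then have "continuous_map R euclideanreal (\<lambda>u. u g)"
      unfolding R_def by (rule continuous_map_product_projection)
    with ce have "continuous_map Z euclideanreal ((\<lambda>u. u g) \<circ> e)"
      by (rule continuous_map_compose)
    then show "continuous_map Z euclideanreal g"
      using g by (simp add: o_def e_def)
  qed
  have coordZ: "continuous_map Z euclideanreal (\<lambda>z. z x)" if "x \<in> topspace X" for x
    unfolding contZ using hC(1)[OF that] that by (simp add: o_def p_def)
  have crR: "completely_regular_space R"
    unfolding R_def by (simp add: completely_regular_space_product_topology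
        metrizable_imp_completely_regular_space metrizable_space_euclidean)
  have "completely_regular_space Z"
    unfolding completely_regular_space_alt'
  proof (intro allI impI)
    fix S z assume "openin Z S" "z \<in> S"
    then obtain U where U: "openin R U" "S = e -` U \<inter> P"
      by (auto simp: Z_def openin_pullback_topology)
    then obtain f where f: "continuous_map R euclideanreal f" "f (e z) = 0"
        "f ` (topspace R - U) \<subseteq> {1}"
      using crR \<open>z \<in> S\<close> unfolding completely_regular_space_alt' by blast
    have "continuous_map Z euclideanreal (f \<circ> e)"
      using ce f(1) by (rule continuous_map_compose)
    moreover have "(f \<circ> e) ` (topspace Z - S) \<subseteq> {1}"
      using f(3) eR U topZ by auto
    ultimately show "\<exists>f. continuous_map Z euclideanreal f \<and> f z = 0 \<and> f ` (topspace Z - S) \<subseteq> {1}"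
      using f(2) by (intro exI[of _ "f \<circ> e"]) auto
  qed
  moreover have "Hausdorff_space Z"
    unfolding Hausdorff_space_def
  proof (intro allI impI, elim conjE)
    fix u v assume uv: "u \<in> topspace Z" "v \<in> topspace Z" "u \<noteq> v"
    then have "u \<in> extensional (topspace X)" "v \<in> extensional (topspace X)"
      by (auto simp: topZ P_def p_def)
    with uv(3) obtain x where x: "x \<in> topspace X" "u x \<noteq> v x"
      by (meson extensionalityI)
    then obtain A B where AB: "open A" "open B" "u x \<in> A" "v x \<in> B" "A \<inter> B = {}"
      using hausdorff by metis
    let ?A = "{z \<in> topspace Z. z x \<in> A}" and ?B = "{z \<in> topspace Z. z x \<in> B}"
    have "openin Z ?A" "openin Z ?B"
      using openin_continuous_map_preimage[OF coordZ[OF x(1)]] AB(1,2) by auto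
    moreover have "u \<in> ?A" "v \<in> ?B" "disjnt ?A ?B"
      using uv AB by (auto simp: disjnt_def)
    ultimately show "\<exists>U V. openin Z U \<and> openin Z V \<and> u \<in> U \<and> v \<in> V \<and> disjnt U V"
      by blast
  qed
  moreover have "kR_space Z"
    unfolding kR_space_def
  proof (intro allI impI)
    fix g assume g: "k_continuous Z g"
    have "k_continuous Y (g \<circ> p)"
      unfolding k_continuous_def
    proof (intro allI impI)
      fix K assume K: "compactin Y K"
      have "compactin Z (p ` K)" using K cp by (rule image_compactin)
      then have "continuous_map (subtopology Z (p ` K)) euclideanreal g"
        using g by (simp add: k_continuous_def)
      moreover have "continuous_map (subtopology Y K) (subtopology Z (p ` K)) p"
        using cp by (auto simp: continuous_map_in_subtopology continuous_map_from_subtopology)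
      ultimately show "continuous_map (subtopology Y K) euclideanreal (g \<circ> p)"
        by (blast intro: continuous_map_compose)
    qed
    then show "continuous_map Z euclideanreal g"
      using kR by (simp add: contZ kR_space_def)
  qed
  moreover have "\<exists>F'. closedin (Cp Z) F' \<and> X homeomorphic_space subtopology (Cp Z) F'"
  proof -
    define H where "H x = (\<lambda>z\<in>P. z x)" for x
    define T where "T g = (\<lambda>y\<in>topspace Y. g (p y))" for g :: "('a \<Rightarrow> real) \<Rightarrow> real"
    define F' where "F' = {g \<in> topspace (Cp Z). T g \<in> F}"
    have pP: "p y \<in> P" if "y \<in> topspace Y" for y using that by (simp add: P_def)
    have HC: "H x \<in> topspace (Cp Z)" if "x \<in> topspace X" for x
    proof -
      have "continuous_map Z euclideanreal (H x)"
        by (rule continuous_map_eq[OF coordZ[OF that]]) (simp add: H_def topZ)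
      then show ?thesis by (simp add: topspace_Cp topZ H_def)
    qed
    have TH: "T (H x) = h x" if "x \<in> topspace X" for x
      by (rule extensionalityI[OF _ hC(2)[OF that]])
        (use that pP in \<open>auto simp: T_def H_def p_def\<close>)
    have HT: "H (h' (T g)) = g" if "g \<in> F'" for g
    proof -
      have TF: "T g \<in> F" and g: "g \<in> extensional P"
        using that by (auto simp: F'_def topspace_Cp topZ)
      show ?thesis
      proof (rule extensionalityI[OF _ g])
        fix z assume "z \<in> P"
        then obtain y where y: "y \<in> topspace Y" "z = p y" by (auto simp: P_def)
        have "H (h' (T g)) z = h (h' (T g)) y"
          using y \<open>z \<in> P\<close> h'X[OF TF] by (simp add: H_def p_def)
        also have "\<dots> = g z" unfolding hh'[OF TF] using y by (simp add: T_def)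
        finally show "H (h' (T g)) z = g z" .
      qed (simp add: H_def)
    qed
    have evZ: "continuous_map (Cp Z) euclideanreal (\<lambda>g. g z)" if "z \<in> P" for z
      unfolding Cp_def using that topZ
      by (intro continuous_map_from_subtopology continuous_map_product_projection) auto
    have cT: "continuous_map (Cp Z) (Cp Y) T"
      unfolding Cp_def[of Y] continuous_map_in_subtopology
    proof
      show "continuous_map (Cp Z) (product_topology (\<lambda>_. euclideanreal) (topspace Y)) T"
        using evZ pP by (auto simp: continuous_map_componentwise T_def)
      have "continuous_map Y euclideanreal (T g)" if "g \<in> topspace (Cp Z)" for g
        by (rule continuous_map_eq[of _ _ "g \<circ> p"])
          (use that contZ in \<open>auto simp: topspace_Cp T_def\<close>)
      then show "T \<in> topspace (Cp Z) \<rightarrow> {f. continuous_map Y euclideanreal f}"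
        by auto
    qed
    have clF': "closedin (Cp Z) F'"
      unfolding F'_def using cT F by (rule closedin_continuous_map_preimage)
    have topF': "topspace (subtopology (Cp Z) F') = F'"
      using closedin_subset[OF clF'] by auto
    have HF': "H x \<in> F'" if "x \<in> topspace X" for x
      using that HC TH hF by (simp add: F'_def)
    have cH: "continuous_map X (subtopology (Cp Z) F') H"
      unfolding continuous_map_in_subtopology
    proof
      have "continuous_map X euclideanreal (\<lambda>x. H x z)" if "z \<in> P" for z
      proof -
        obtain y where y: "y \<in> topspace Y" "z = p y" using \<open>z \<in> P\<close> by (auto simp: P_def)
        have "continuous_map X (Cp Y) h"
          using ch by (simp add: continuous_map_in_subtopology)
        from continuous_map_compose[OF this ev[OF y(1)]]
        have "continuous_map X euclideanreal (\<lambda>x. h x y)" by (simp add: o_def)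
        then show ?thesis
          by (rule continuous_map_eq) (use y pP in \<open>auto simp: H_def p_def\<close>)
      qed
      then have "continuous_map X (product_topology (\<lambda>_. euclideanreal) P) H"
        by (auto simp: continuous_map_componentwise H_def)
      then show "continuous_map X (Cp Z) H"
        using HC by (auto simp: Cp_def topZ continuous_map_in_subtopology)
      show "H \<in> topspace X \<rightarrow> F'" using HF' by auto
    qed
    have "continuous_map (subtopology (Cp Z) F') (subtopology (Cp Y) F) T"
      using cT by (auto simp: continuous_map_in_subtopology continuous_map_from_subtopology F'_def)
    from continuous_map_compose[OF this ch']
    have "continuous_map (subtopology (Cp Z) F') X (h' \<circ> T)" .
    with cH have "homeomorphic_maps X (subtopology (Cp Z) F') H (h' \<circ> T)"
      unfolding homeomorphic_maps_def topF' using TH h'h HT by simp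
    with clF' show ?thesis by (auto simp: homeomorphic_space_def)
  qed
  ultimately show ?thesis
    by (auto simp: kappa_space_def kappa_space_via_def tychonoff_space_def)
qed

section \<open>The Stone-Cech compactification\<close>

text \<open>The closure of the image of \<open>X\<close> in the cube with one factor for each continuous function
  from \<open>X\<close> to \<open>[-1,1]\<close>; the lemmas below show that, for Tychonoff \<open>X\<close>, this is a compactification
  to which such functions extend.\<close>

definition sc_embed :: "'a topology \<Rightarrow> 'a \<Rightarrow> ('a \<Rightarrow> real) \<Rightarrow> real" where
  "sc_embed X x = (\<lambda>f\<in>topspace (Cp_unit X). f x)"

definition stone_cech :: "'a topology \<Rightarrow> (('a \<Rightarrow> real) \<Rightarrow> real) topology" where
  "stone_cech X =
     (let Q = product_topology (\<lambda>_. top_of_set {-1..1}) (topspace (Cp_unit X))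
      in subtopology Q (Q closure_of (sc_embed X ` topspace X)))"

definition sc_extend :: "'a topology \<Rightarrow> ('a \<Rightarrow> real) \<Rightarrow> (('a \<Rightarrow> real) \<Rightarrow> real) \<Rightarrow> real" where
  "sc_extend X f =
     (THE g. g \<in> extensional (topspace (stone_cech X)) \<and>
             continuous_map (stone_cech X) euclideanreal g \<and>
             (\<forall>x\<in>topspace X. g (sc_embed X x) = f x))"

lemma compact_space_stone_cech: "compact_space (stone_cech X)"
  unfolding stone_cech_def Let_def
  by (intro compact_space_subtopology closedin_compact_space closedin_closure_of)
    (simp add: compact_space_product_topology compact_space_subtopology)

lemma Hausdorff_space_stone_cech: "Hausdorff_space (stone_cech X)"
  unfolding stone_cech_def Let_def
  by (intro Hausdorff_space_subtopology)
    (simp add: Hausdorff_space_product_topology Hausdorff_space_subtopology)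

lemma sc_embed_in_cube:
  assumes "x \<in> topspace X"
  shows "sc_embed X x \<in> topspace (product_topology (\<lambda>_. top_of_set {-1..1}) (topspace (Cp_unit X)))"
  using assms by (auto simp: sc_embed_def topspace_Cp_unit)

lemma sc_embed_in_stone_cech:
  assumes "x \<in> topspace X"
  shows "sc_embed X x \<in> topspace (stone_cech X)"
proof -
  define Q where "Q = product_topology (\<lambda>_. top_of_set {-1..1::real}) (topspace (Cp_unit X))"
  have sub: "sc_embed X ` topspace X \<subseteq> topspace Q"
    unfolding Q_def by (blast intro: sc_embed_in_cube)
  have "sc_embed X x \<in> Q closure_of (sc_embed X ` topspace X)"
    using closure_of_subset[OF sub] assms by blast
  moreover have "sc_embed X x \<in> topspace Q" using sub assms by blast
  ultimately show ?thesis
    unfolding stone_cech_def Let_def Q_def[symmetric] topspace_subtopology by blast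
qed

lemma stone_cech_dense:
  "stone_cech X closure_of (sc_embed X ` topspace X) = topspace (stone_cech X)"
proof -
  define Q where "Q = product_topology (\<lambda>_. top_of_set {-1..1::real}) (topspace (Cp_unit X))"
  let ?E = "sc_embed X ` topspace X"
  have sc: "stone_cech X = subtopology Q (Q closure_of ?E)"
    by (simp only: stone_cech_def Let_def Q_def)
  have "?E \<subseteq> Q closure_of ?E"
    unfolding Q_def by (rule closure_of_subset) (blast intro: sc_embed_in_cube)
  then have "Q closure_of ?E \<inter> ?E = ?E" by blast
  then have "stone_cech X closure_of ?E = Q closure_of ?E"
    by (simp only: sc closure_of_subtopology Int_absorb)
  also have "\<dots> = topspace (stone_cech X)"
    using closure_of_subset_topspace[of Q ?E] by (simp only: sc topspace_subtopology Int_absorb1)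
  finally show ?thesis .
qed

lemma continuous_map_sc_embed: "continuous_map X (stone_cech X) (sc_embed X)"
proof -
  have "continuous_map X (top_of_set {-1..1}) (\<lambda>x. sc_embed X x f)"
    if "f \<in> topspace (Cp_unit X)" for f
    using that by (auto simp: sc_embed_def topspace_Cp_unit topspace_Cp continuous_map_in_subtopology)
  then have "continuous_map X (product_topology (\<lambda>_. top_of_set {-1..1}) (topspace (Cp_unit X)))
     (sc_embed X)"
    by (auto simp: continuous_map_componentwise sc_embed_def)
  then show ?thesis
    using sc_embed_in_stone_cech[of _ X]
    by (auto simp: stone_cech_def Let_def continuous_map_in_subtopology)
qed

lemma Cp_unit_separates:
  assumes "tychonoff_space X" "openin X S" "x \<in> S"
  obtains f where "f \<in> topspace (Cp_unit X)" "f x = 0" "\<And>y. y \<in> topspace X - S \<Longrightarrow> f y = 1"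
proof -
  have "closedin X (topspace X - S)" "x \<in> topspace X - (topspace X - S)"
    using assms openin_subset by fastforce+
  then obtain g where g: "continuous_map X (top_of_set {0..1::real}) g" "g x = 0"
      "g ` (topspace X - S) \<subseteq> {1}"
    using assms(1) unfolding tychonoff_space_def completely_regular_space_def by blast
  have "continuous_map X euclideanreal (restrict g (topspace X))"
    using g(1) by (auto simp: continuous_map_in_subtopology)
  moreover have "restrict g (topspace X) ` topspace X \<subseteq> {-1..1}"
    using continuous_map_image_subset_topspace[OF g(1)] by fastforce
  ultimately have "restrict g (topspace X) \<in> topspace (Cp_unit X)"
    by (auto simp: topspace_Cp_unit topspace_Cp)
  then show thesis
    by (rule that) (use g assms(3) openin_subset[OF assms(2)] in \<open>auto simp: subset_iff\<close>)
qed

lemma embedding_map_sc_embed: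
  assumes X: "tychonoff_space X"
  shows "embedding_map X (stone_cech X) (sc_embed X)"
proof -
  let ?E = "sc_embed X ` topspace X"
  let ?S = "subtopology (stone_cech X) ?E"
  have topS: "topspace ?S = ?E" using sc_embed_in_stone_cech[of _ X] by auto
  have proj: "continuous_map ?S euclideanreal (\<lambda>u. u f)" if "f \<in> topspace (Cp_unit X)" for f
  proof -
    have "continuous_map (product_topology (\<lambda>_. top_of_set {-1..1::real}) (topspace (Cp_unit X)))
        (top_of_set {-1..1}) (\<lambda>u. u f)"
      using that by (rule continuous_map_product_projection)
    then show ?thesis
      unfolding stone_cech_def Let_def
      by (intro continuous_map_from_subtopology) (simp add: continuous_map_in_subtopology)
  qed
  have inj: "inj_on (sc_embed X) (topspace X)"
  proof (rule inj_onI, rule ccontr)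
    fix x y assume xy: "x \<in> topspace X" "y \<in> topspace X" "sc_embed X x = sc_embed X y" "x \<noteq> y"
    have "openin X (topspace X - {y})"
      using X xy by (simp add: tychonoff_space_def closedin_Hausdorff_singleton openin_diff)
    then obtain f where f: "f \<in> topspace (Cp_unit X)" "f x = 0" "f y = 1"
      using Cp_unit_separates[OF X, of "topspace X - {y}" x] xy by blast
    have "f x = f y" using xy(3) f(1) by (metis restrict_apply' sc_embed_def)
    with f show False by simp
  qed
  have "open_map X ?S (sc_embed X)"
    unfolding open_map_def
  proof (intro allI impI)
    fix V assume V: "openin X V"
    show "openin ?S (sc_embed X ` V)"
    proof (subst openin_subopen, intro ballI)
      fix u assume "u \<in> sc_embed X ` V"
      then obtain x where x: "x \<in> V" "u = sc_embed X x" by auto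
      then have xX: "x \<in> topspace X" using V openin_subset by blast
      obtain f where f: "f \<in> topspace (Cp_unit X)" "f x = 0"
          "\<And>y. y \<in> topspace X - V \<Longrightarrow> f y = 1"
        using Cp_unit_separates[OF X V x(1)] by blast
      let ?W = "{w \<in> topspace ?S. w f \<in> {..<1}}"
      have "openin ?S ?W"
        using openin_continuous_map_preimage[OF proj[OF f(1)], of "{..<1}"] by simp
      moreover have "u \<in> ?W"
        using x xX f topS by (auto simp: sc_embed_def)
      moreover have "?W \<subseteq> sc_embed X ` V"
        unfolding topS using f by (fastforce simp: sc_embed_def)
      ultimately show "\<exists>T. openin ?S T \<and> u \<in> T \<and> T \<subseteq> sc_embed X ` V" by blast
    qed
  qed
  moreover have "continuous_map X ?S (sc_embed X)"
    using continuous_map_sc_embed by (auto simp: continuous_map_in_subtopology)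
  ultimately show ?thesis
    unfolding embedding_map_def using inj topS
    by (intro bijective_open_imp_homeomorphic_map) auto
qed

lemma sc_extend_eq:
  assumes f: "f \<in> topspace (Cp_unit X)"
  shows "sc_extend X f = (\<lambda>u\<in>topspace (stone_cech X). u f)" (is "_ = ?g")
proof -
  have "continuous_map (product_topology (\<lambda>_. top_of_set {-1..1::real}) (topspace (Cp_unit X)))
      (top_of_set {-1..1}) (\<lambda>u. u f)"
    using f by (rule continuous_map_product_projection)
  then have "continuous_map (stone_cech X) euclideanreal (\<lambda>u. u f)"
    unfolding stone_cech_def Let_def
    by (intro continuous_map_from_subtopology) (simp add: continuous_map_in_subtopology)
  then have c: "continuous_map (stone_cech X) euclideanreal ?g"
    by (rule continuous_map_eq) simp
  have v: "?g (sc_embed X x) = f x" if "x \<in> topspace X" for x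
    using that f sc_embed_in_stone_cech[OF that] by (simp add: sc_embed_def)
  have uniq: "g = ?g" if g: "g \<in> extensional (topspace (stone_cech X))"
    "continuous_map (stone_cech X) euclideanreal g"
    "\<forall>x\<in>topspace X. g (sc_embed X x) = f x" for g
  proof (rule extensionalityI[OF g(1) restrict_extensional])
    fix u assume "u \<in> topspace (stone_cech X)"
    then have "u \<in> stone_cech X closure_of (sc_embed X ` topspace X)"
      by (simp only: stone_cech_dense)
    then show "g u = ?g u"
    proof (rule forall_in_closure_of_eq[OF _ _ g(2) c])
      fix w assume "w \<in> sc_embed X ` topspace X"
      then obtain x where "x \<in> topspace X" "w = sc_embed X x" by blast
      then show "g w = ?g w" by (simp only: v g(3))
    qed simp
  qed
  show ?thesis
    unfolding sc_extend_def using c v uniq by (intro the_equality) auto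
qed

section \<open>Measures\<close>

definition regular_borel_prob :: "'a topology \<Rightarrow> 'a measure set" where
  "regular_borel_prob K =
     {M. space M = topspace K \<and> sets M = sigma_sets (topspace K) {U. openin K U} \<and>
         emeasure M (space M) = 1 \<and>
         (\<forall>B\<in>sets M.
            emeasure M B = (SUP C\<in>{C. compactin K C \<and> C \<in> sets M \<and> C \<subseteq> B}. emeasure M C) \<and>
            emeasure M B = (INF U\<in>{U. openin K U \<and> B \<subseteq> U}. emeasure M U))}"

definition P_discrete :: "'a topology \<Rightarrow> (('a \<Rightarrow> real) \<Rightarrow> real) measure set" where
  "P_discrete X =
     {\<mu> \<in> regular_borel_prob (stone_cech X).
        \<exists>A. countable A \<and> A \<subseteq> topspace X \<and> emeasure \<mu> (sc_embed X ` A) = 1}"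

definition P_kappa :: "'a topology \<Rightarrow> (('a \<Rightarrow> real) \<Rightarrow> real) measure set" where
  "P_kappa X =
     {\<mu> \<in> regular_borel_prob (stone_cech X).
        k_continuous (Cp_unit X) (\<lambda>f. \<integral>u. sc_extend X f u \<partial>\<mu>)}"

definition universal_kappa_measure_zero :: "'a topology \<Rightarrow> bool" where
  "universal_kappa_measure_zero X \<longleftrightarrow> P_kappa X = P_discrete X"

end

theory Submission
  imports Defs
begin

text \<open>Suppose that no subsequence of \<open>A\<^sub>n\<close> is strongly point-finite.  Compact subsets of \<open>C\<^sub>p(X)\<close> are
  pointwise bounded, so each of them meets only finitely many of the open sets
  \<open>{f. \<forall>x\<in>A\<^sub>n. f x > n}\<close>; a sum of bump functions on these sets is then \<open>k\<close>-continuous, but it is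
  discontinuous at \<open>0\<close> because a finite set of coordinates misses almost all of the \<open>A\<^sub>n\<close>.

  The space \<open>C\<^sub>p(X, [-1,1])\<close> is a retract of \<open>C\<^sub>p(X)\<close>, so a \<open>k\<close>-continuous measure is continuous at
  \<open>0\<close>: up to \<open>1/n\<close> its mass lies on a finite subset of \<open>X\<close>, by Urysohn's lemma and inner regularity.

  The space \<open>X\<close> is closed in \<open>C\<^sub>p(C\<^sub>p(X))\<close> because the point evaluations are exactly the continuous
  unital multiplicative functionals.

  A compact set that is not scattered has a closed subset with a countable \<open>\<pi>\<close>-base and no isolated
  points.  If the finite sets \<open>A\<^sub>n\<close> eventually meet each member of the \<open>\<pi>\<close>-base, open sets around
  a subsequence of the \<open>A\<^sub>n\<close> have a dense upper limit, against property \<open>(\<kappa>)\<close>.\<close>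

section \<open>The topology of pointwise convergence\<close>

lemma continuous_map_Cp_eval:
  "x \<in> topspace X \<Longrightarrow> continuous_map (Cp X) euclideanreal (\<lambda>f. f x)"
  unfolding Cp_def by (intro continuous_map_from_subtopology continuous_map_product_projection)

lemma continuous_map_into_Cp:
  assumes "\<And>z. z \<in> topspace Z \<Longrightarrow> g z \<in> topspace (Cp X)"
    and "\<And>x. x \<in> topspace X \<Longrightarrow> continuous_map Z euclideanreal (\<lambda>z. g z x)"
  shows "continuous_map Z (Cp X) g"
proof -
  have "g \<in> topspace Z \<rightarrow> extensional (topspace X)"
    using assms(1) by (auto simp: topspace_Cp)
  moreover have "g \<in> topspace Z \<rightarrow> {f. continuous_map X euclideanreal f}"
    using assms(1) by (auto simp: topspace_Cp)
  ultimately show ?thesis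
    using assms(2) unfolding Cp_def continuous_map_in_subtopology
    by (simp add: continuous_map_componentwise image_subset_iff_funcset)
qed

text \<open>A basic open box constrains only finitely many coordinates. Agreement with
  \<open>f\<close> on these, rather than closeness, is the useful form: the lemma is later applied
  around the zero function, with test functions vanishing on \<open>F\<close>.\<close>

lemma Cp_open_finite_support:
  assumes "openin (Cp X) W" "f \<in> W"
  obtains F where "finite F" "F \<subseteq> topspace X"
    "\<forall>g\<in>topspace (Cp X). (\<forall>x\<in>F. g x = f x) \<longrightarrow> g \<in> W"
proof -
  obtain T where T: "openin (product_topology (\<lambda>_. euclideanreal) (topspace X)) T"
    "W = T \<inter> {f. continuous_map X euclideanreal f}"
    using assms(1) unfolding Cp_def openin_subtopology by blast
  then obtain U where U: "finite {x \<in> topspace X. U x \<noteq> UNIV}"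
      "f \<in> Pi\<^sub>E (topspace X) U" "Pi\<^sub>E (topspace X) U \<subseteq> T"
    using assms(2) unfolding openin_product_topology_alt by (metis IntD1 topspace_euclidean)
  show thesis
  proof (rule that[of "{x \<in> topspace X. U x \<noteq> UNIV}"])
    have "g \<in> W"
      if g: "g \<in> topspace (Cp X)" "\<forall>x\<in>{x \<in> topspace X. U x \<noteq> UNIV}. g x = f x" for g
    proof -
      have "g x \<in> U x" if "x \<in> topspace X" for x
        using g(2) that U(2) by (cases "U x = UNIV") auto
      then have "g \<in> Pi\<^sub>E (topspace X) U"
        using g(1) by (auto simp: topspace_Cp PiE_iff)
      then show ?thesis using g(1) U(3) T(2) by (auto simp: topspace_Cp)
    qed
    then show "\<forall>g\<in>topspace (Cp X). (\<forall>x\<in>{x \<in> topspace X. U x \<noteq> UNIV}. g x = f x) \<longrightarrow> g \<in> W"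
      by blast
  qed (use U(1) in auto)
qed

lemma restrict_in_topspace_Cp:
  assumes "continuous_map X euclideanreal f"
  shows "restrict f (topspace X) \<in> topspace (Cp X)"
  using assms by (auto simp: topspace_Cp)

lemma tychonoff_space_Cp: "tychonoff_space (Cp X)"
  unfolding tychonoff_space_def Cp_def
  by (simp add: completely_regular_space_subtopology completely_regular_space_product_topology
      Hausdorff_space_subtopology Hausdorff_space_product_topology
      metrizable_imp_completely_regular_space metrizable_space_euclidean)

lemma closedin_tychonoff_finite:
  assumes "tychonoff_space X" "finite F" "F \<subseteq> topspace X"
  shows "closedin X F"
  using assms by (simp add: tychonoff_space_def closedin_Hausdorff_finite)

lemma Cp_interpolate:
  assumes X: "tychonoff_space X" and "finite A" "finite F" "A \<subseteq> topspace X" "F \<subseteq> topspace X"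
    and "A \<inter> F = {}"
  obtains f where "f \<in> topspace (Cp X)" "\<And>x. x \<in> A \<Longrightarrow> f x = c" "\<And>x. x \<in> F \<Longrightarrow> f x = 0"
proof -
  obtain f where "continuous_map X euclideanreal f" "f ` F \<subseteq> {0}" "f ` A \<subseteq> {c}"
    using Urysohn_completely_regular_compact_closed_alt[of X A F 0 c] assms
      closedin_tychonoff_finite[OF X] finite_imp_compactin[of A X]
    by (auto simp: disjnt_def tychonoff_space_def)
  then show thesis
    using assms by (intro that[of "restrict f (topspace X)"] restrict_in_topspace_Cp) auto
qed

section \<open>Property \<open>(\<kappa>)\<close>\<close>

text \<open>On a compact set only finitely many \<open>h i\<close> are nonzero somewhere, so the sum
  agrees there with one fixed finite sum. Hence it is k-continuous, and the k_R-property yields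
  continuity on all of \<open>Z\<close>.\<close>

lemma kR_space_locally_finite_sum:
  fixes h :: "'i \<Rightarrow> 'b \<Rightarrow> real"
  assumes "kR_space Z" and cont: "\<And>i. continuous_map Z euclideanreal (h i)"
    and fin: "\<And>K. compactin Z K \<Longrightarrow> finite {i. \<exists>z\<in>K. h i z \<noteq> 0}"
  shows "continuous_map Z euclideanreal (\<lambda>z. \<Sum>i | h i z \<noteq> 0. h i z)"
proof -
  have "k_continuous Z (\<lambda>z. \<Sum>i | h i z \<noteq> 0. h i z)"
    unfolding k_continuous_def
  proof (intro allI impI)
    fix K assume K: "compactin Z K"
    let ?N = "{i. \<exists>z\<in>K. h i z \<noteq> 0}"
    have "continuous_map (subtopology Z K) euclideanreal (\<lambda>z. \<Sum>i\<in>?N. h i z)"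
      using fin[OF K] cont by (intro continuous_map_sum continuous_map_from_subtopology)
    moreover have "(\<Sum>i\<in>?N. h i z) = (\<Sum>i | h i z \<noteq> 0. h i z)" if "z \<in> K" for z
      using that by (intro sum.mono_neutral_right fin[OF K]) auto
    ultimately show "continuous_map (subtopology Z K) euclideanreal (\<lambda>z. \<Sum>i | h i z \<noteq> 0. h i z)"
      by (rule continuous_map_eq) auto
  qed
  with assms(1) show ?thesis by (simp add: kR_space_def)
qed

text \<open>The increasing enumeration of \<open>N\<close> is the required subsequence; its
  injectivity carries point-finiteness over from \<open>N\<close> to the new indices.\<close>

lemma strongly_point_finite_subsequence:
  fixes A :: "nat \<Rightarrow> 'a set"
  assumes "infinite N" and U: "\<And>n. n \<in> N \<Longrightarrow> openin X (U n) \<and> A n \<subseteq> U n"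
    and fin: "\<And>x. x \<in> topspace X \<Longrightarrow> finite {n \<in> N. x \<in> U n}"
  shows "\<exists>r :: nat \<Rightarrow> nat. strict_mono r \<and> strongly_point_finite X UNIV (A \<circ> r)"
proof -
  let ?r = "enumerate N"
  have r: "strict_mono ?r" "\<And>i. ?r i \<in> N"
    using assms(1) by (auto simp: strict_mono_enumerate enumerate_in_set)
  have "finite {i. x \<in> U (?r i)}" if "x \<in> topspace X" for x
  proof (rule finite_imageD)
    show "finite (?r ` {i. x \<in> U (?r i)})"
      by (rule finite_subset[OF _ fin[OF that]]) (use r in auto)
    show "inj_on ?r {i. x \<in> U (?r i)}"
      using r(1) by (meson inj_on_subset strict_mono_imp_inj_on subset_UNIV)
  qed
  then have "strongly_point_finite X UNIV (A \<circ> ?r)"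
    unfolding strongly_point_finite_def
    by (intro exI[of _ "U \<circ> ?r"]) (use U r in auto)
  with r(1) show ?thesis by blast
qed

lemma compactin_Cp_pointwise_bounded:
  assumes "compactin (Cp X) K" "x \<in> topspace X"
  obtains n :: nat where "\<And>f. f \<in> K \<Longrightarrow> f x \<le> real n"
proof -
  have "compact ((\<lambda>f. f x) ` K)"
    using image_compactin[OF assms(1) continuous_map_Cp_eval[OF assms(2)]] by simp
  then have "bdd_above ((\<lambda>f. f x) ` K)"
    by (simp add: bounded_imp_bdd_above compact_imp_bounded)
  then obtain b where "\<And>f. f \<in> K \<Longrightarrow> f x \<le> b" unfolding bdd_above_def by auto
  then show thesis by (metis that order_trans real_arch_simple)
qed

theorem kR_space_Cp_imp_property_kappa:
  assumes X: "tychonoff_space X" and kR: "kR_space (Cp X)"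
  shows "property_kappa X"
  unfolding property_kappa_def
proof (intro allI impI, elim conjE, rule ccontr)
  fix A :: "nat \<Rightarrow> 'a set"
  assume A: "\<forall>n. finite (A n) \<and> A n \<subseteq> topspace X" and disj: "disjoint_family A"
    and no_subseq: "\<nexists>r :: nat \<Rightarrow> nat. strict_mono r \<and> strongly_point_finite X UNIV (A \<circ> r)"
  \<comment> \<open>For nonempty \<open>A n\<close>, the bump \<open>h n\<close> is nonzero exactly
    at the functions exceeding \<open>n\<close> on all of \<open>A n\<close>. The empty product
    would be 1; the value 0 for empty \<open>A n\<close> makes every \<open>h n\<close> vanish at
    the zero function.\<close>
  define h where "h n f =
      (if A n = {} then 0 else \<Prod>x\<in>A n. min 1 (max 0 (f x - real n)))" for n f
  define H where "H f = (\<Sum>n | h n f \<noteq> 0. h n f)" for f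
  have fin: "finite {n. \<exists>f\<in>K. h n f \<noteq> 0}" (is "finite ?N") if K: "compactin (Cp X) K" for K
  proof (rule ccontr)
    assume inf: "infinite ?N"
    have "\<forall>n\<in>?N. \<exists>f. f \<in> K \<and> h n f \<noteq> 0" by blast
    then obtain g where g: "\<And>n. n \<in> ?N \<Longrightarrow> g n \<in> K \<and> h n (g n) \<noteq> 0"
      using bchoice[of ?N "\<lambda>n f. f \<in> K \<and> h n f \<noteq> 0"] by auto
    \<comment> \<open>If \<open>K\<close> met infinitely many supports, these sets would be open
      neighbourhoods of the corresponding \<open>A n\<close>. A point of \<open>U n\<close> has
      \<open>g n x > n\<close>, so boundedness of \<open>K\<close> at \<open>x\<close> leaves only
      finitely many such \<open>n\<close>.\<close>
    define U where "U n = {x \<in> topspace X. g n x \<in> {real n<..}}" for n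
    have "openin X (U n) \<and> A n \<subseteq> U n" if n: "n \<in> ?N" for n
    proof
      have "g n \<in> topspace (Cp X)" using g[OF n] compactin_subset_topspace[OF K] by blast
      then show "openin X (U n)"
        unfolding U_def by (intro openin_continuous_map_preimage) (auto simp: topspace_Cp)
      have "g n x \<in> {real n<..}" if x: "x \<in> A n" for x
      proof (rule ccontr)
        assume "g n x \<notin> {real n<..}"
        then have "min 1 (max 0 (g n x - real n)) = 0" by simp
        then have "h n (g n) = 0"
          using x A unfolding h_def by (auto intro!: prod_zero)
        with g[OF n] show False by blast
      qed
      then show "A n \<subseteq> U n"
        using A by (auto simp: U_def)
    qed
    moreover have "finite {n \<in> ?N. x \<in> U n}" if x: "x \<in> topspace X" for x
    proof -
      obtain m :: nat where m: "\<And>f. f \<in> K \<Longrightarrow> f x \<le> real m"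
        using compactin_Cp_pointwise_bounded[OF K x] by blast
      have "n \<le> m" if "n \<in> ?N" "x \<in> U n" for n
        using m[of "g n"] g[OF that(1)] that(2) by (auto simp: U_def)
      then have "{n \<in> ?N. x \<in> U n} \<subseteq> {..m}" by blast
      then show ?thesis by (rule finite_subset) simp
    qed
    ultimately show False
      using strongly_point_finite_subsequence[OF inf, of X U A] no_subseq by blast
  qed
  have cont: "continuous_map (Cp X) euclideanreal (h n)" for n
  proof (cases "A n = {}")
    case False
    have "continuous_map (Cp X) euclideanreal (\<lambda>f. \<Prod>x\<in>A n. min 1 (max 0 (f x - real n)))"
      using A by (intro continuous_map_prod continuous_map_real_min continuous_map_real_max
          continuous_map_diff continuous_map_Cp_eval continuous_map_canonical_const) auto
    with False show ?thesis by (simp add: h_def[abs_def])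
  qed (simp add: h_def[abs_def])
  have contH: "continuous_map (Cp X) euclideanreal H"
    unfolding H_def[abs_def] using kR cont fin by (rule kR_space_locally_finite_sum)
  let ?z = "\<lambda>x\<in>topspace X. 0::real"
  have "h n ?z = 0" for n
    using A by (cases "A n = {}") (auto simp: h_def intro!: prod_zero)
  then have H0: "H ?z = 0" by (simp add: H_def)
  have z: "?z \<in> topspace (Cp X)" by (intro restrict_in_topspace_Cp) simp
  let ?W = "{f \<in> topspace (Cp X). H f \<in> {..<1}}"
  have W: "openin (Cp X) ?W" "?z \<in> ?W"
    using openin_continuous_map_preimage[OF contH, of "{..<1}"] z H0 by auto
  obtain F where F: "finite F" "F \<subseteq> topspace X"
      "\<forall>g\<in>topspace (Cp X). (\<forall>x\<in>F. g x = ?z x) \<longrightarrow> g \<in> ?W"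
    by (rule Cp_open_finite_support[OF W])
  \<comment> \<open>Infinitely many empty sets would already form a strongly point-finite
    subsequence, with empty neighbourhoods.\<close>
  have "finite {n. A n = {}}"
    using strongly_point_finite_subsequence[of "{n. A n = {}}" X "\<lambda>_. {}" A] no_subseq by auto
  moreover have "finite {n. x \<in> A n}" for x
  proof (cases "\<exists>m. x \<in> A m")
    case True
    then obtain m where "x \<in> A m" by blast
    then have "{n. x \<in> A n} \<subseteq> {m}"
      using disj by (auto simp: disjoint_family_on_def)
    then show ?thesis by (rule finite_subset) simp
  qed auto
  ultimately have "finite ({n. A n = {}} \<union> (\<Union>x\<in>F. {n. x \<in> A n}))"
    using F(1) by blast
  then obtain n where "n \<notin> {n. A n = {}} \<union> (\<Union>x\<in>F. {n. x \<in> A n})"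
    using ex_new_if_finite infinite_UNIV_nat by blast
  then have n: "A n \<noteq> {}" "A n \<inter> F = {}" by auto
  \<comment> \<open>Vanishing on \<open>F\<close> forces \<open>H f < 1\<close>, while the value
    \<open>n + 1\<close> on \<open>A n\<close> makes every factor of \<open>h n f\<close> equal to
    1, so that \<open>H f\<close> is at least 1.\<close>
  obtain f where f: "f \<in> topspace (Cp X)" "\<And>x. x \<in> A n \<Longrightarrow> f x = real n + 1"
      "\<And>x. x \<in> F \<Longrightarrow> f x = 0"
    using Cp_interpolate[OF X, of "A n" F "real n + 1"] A F n by blast
  have "H f < 1" using F(3) f(1,3) F(2) by (auto simp: subset_iff)
  have hn: "h n f = 1" using n(1) f(2) by (simp add: h_def)
  \<comment> \<open>A sum over an infinite set is 0 by default, so finiteness must be known before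
    one nonnegative summand can bound the sum from below. It follows from compactness of a
    singleton.\<close>
  have "finite {m. h m f \<noteq> 0}" using fin[of "{f}"] f(1) by (simp add: compactin_sing)
  then have "h n f \<le> H f"
    unfolding H_def using hn by (intro member_le_sum) (auto simp: h_def intro!: prod_nonneg)
  with \<open>H f < 1\<close> hn show False by simp
qed

section \<open>Embedding into the double function space\<close>

definition Cp_delta :: "'a topology \<Rightarrow> 'a \<Rightarrow> ('a \<Rightarrow> real) \<Rightarrow> real" where
  "Cp_delta X x = (\<lambda>f\<in>topspace (Cp X). f x)"

lemma Cp_delta_in_Cp:
  "x \<in> topspace X \<Longrightarrow> Cp_delta X x \<in> topspace (Cp (Cp X))"
  unfolding Cp_delta_def by (intro restrict_in_topspace_Cp continuous_map_Cp_eval)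

text \<open>If a limit \<phi> of evaluations is not an evaluation, every point \<open>x\<close> has
  a function \<open>g x\<close> with \<phi>\<open>(g x)\<close> different from \<open>g x x\<close>.
  Continuity of \<phi> at zero yields a finite set \<open>F\<close> such that \<phi> is below 1 on
  functions vanishing on \<open>F\<close>. The normalised product of the functions
  \<open>g x - g x x\<close> over \<open>F\<close> vanishes on \<open>F\<close>, yet \<phi> maps it
  to 1.\<close>

lemma closedin_Cp_delta:
  "closedin (Cp (Cp X)) (Cp_delta X ` topspace X)"
proof -
  let ?D = "Cp_delta X ` topspace X"
  have "\<phi> \<in> ?D" if \<phi>: "\<phi> \<in> Cp (Cp X) closure_of ?D" for \<phi>
  proof (rule ccontr)
    assume notin: "\<phi> \<notin> ?D"
    have \<phi>top: "\<phi> \<in> topspace (Cp (Cp X))"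
      using \<phi> by (simp add: in_closure_of)
    define z where "z = (\<lambda>y\<in>topspace X. 0::real)"
    have z: "z \<in> topspace (Cp X)"
      unfolding z_def by (intro restrict_in_topspace_Cp) simp
    have zero: "\<phi> z = 0"
    proof (rule forall_in_closure_of_eq[OF \<phi>, of euclideanreal])
      show "\<psi> z = 0" if "\<psi> \<in> ?D" for \<psi>
        using that z by (auto simp: Cp_delta_def) (simp add: z_def)
    qed (use z in \<open>auto intro: continuous_map_Cp_eval\<close>)
    have ex: "\<exists>f\<in>topspace (Cp X). \<phi> f \<noteq> f x" if x: "x \<in> topspace X" for x
    proof (rule ccontr)
      assume "\<not> ?thesis"
      then have "\<phi> = Cp_delta X x"
        using \<phi>top by (intro extensionalityI[of _ "topspace (Cp X)"]) (auto simp: Cp_delta_def topspace_Cp[of "Cp X"])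
      with notin x show False by blast
    qed
    then obtain g where g: "\<And>x. x \<in> topspace X \<Longrightarrow> g x \<in> topspace (Cp X) \<and> \<phi> (g x) \<noteq> g x x"
      by metis
    let ?W = "{f \<in> topspace (Cp X). \<phi> f \<in> {..<1}}"
    have W: "openin (Cp X) ?W"
      using \<phi>top by (intro openin_continuous_map_preimage) (auto simp: topspace_Cp[of "Cp X"])
    have zW: "z \<in> ?W" using zero z by simp
    obtain F where F: "finite F" "F \<subseteq> topspace X"
        "\<forall>f\<in>topspace (Cp X). (\<forall>x\<in>F. f x = z x) \<longrightarrow> f \<in> ?W"
      by (rule Cp_open_finite_support[OF W zW])
    \<comment> \<open>By multiplicativity \<open>c\<close> is the value that \<phi> takes at the
      product before normalisation; it is nonzero by the choice of \<open>g\<close>.\<close>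
    define c where "c = (\<Prod>x\<in>F. (\<phi> (g x) - g x x))"
    have "\<phi> (g x) - g x x \<noteq> 0" if "x \<in> F" for x
      using g[of x] F(2) that by auto
    then have "c \<noteq> 0" using F(1) by (simp add: c_def)
    define p where "p y = inverse c * (\<Prod>x\<in>F. (g x y - g x x))" for y
    have gc: "continuous_map X euclideanreal (g x)" if "x \<in> F" for x
      using g[of x] F(2) that by (auto simp: topspace_Cp)
    have p: "restrict p (topspace X) \<in> topspace (Cp X)"
      unfolding p_def[abs_def] using gc F(1)
      by (intro restrict_in_topspace_Cp continuous_map_real_mult continuous_map_prod
          continuous_map_diff continuous_map_canonical_const) auto
    \<comment> \<open>Point evaluations are multiplicative, hence so are the elements of the closure.\<close>
    have "\<phi> (restrict p (topspace X)) = inverse c * (\<Prod>x\<in>F. (\<phi> (g x) - g x x))"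
    proof (rule forall_in_closure_of_eq[OF \<phi>, of euclideanreal])
      show "continuous_map (Cp (Cp X)) euclideanreal (\<lambda>\<phi>. inverse c * (\<Prod>x\<in>F. (\<phi> (g x) - g x x)))"
        using F g by (intro continuous_map_real_mult continuous_map_prod continuous_map_diff
            continuous_map_canonical_const continuous_map_Cp_eval) auto
      show "continuous_map (Cp (Cp X)) euclideanreal (\<lambda>\<phi>. \<phi> (restrict p (topspace X)))"
        using p by (rule continuous_map_Cp_eval)
      fix \<psi> assume "\<psi> \<in> ?D"
      then obtain y where y: "y \<in> topspace X" "\<psi> = Cp_delta X y" by blast
      have "(\<Prod>x\<in>F. (g x y - g x x)) = (\<Prod>x\<in>F. (\<psi> (g x) - g x x))"
        using g F(2) y(2) by (intro prod.cong) (auto simp: Cp_delta_def subset_iff)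
      then show "\<psi> (restrict p (topspace X)) = inverse c * (\<Prod>x\<in>F. (\<psi> (g x) - g x x))"
        using p y by (simp add: Cp_delta_def p_def)
    qed simp
    then have "\<phi> (restrict p (topspace X)) = 1"
      using \<open>c \<noteq> 0\<close> by (simp add: c_def)
    moreover have "\<forall>x\<in>F. restrict p (topspace X) x = z x"
      using F(1,2) by (auto simp: p_def z_def intro!: prod_zero)
    then have "restrict p (topspace X) \<in> ?W" using F(3) p by blast
    ultimately show False by simp
  qed
  then show ?thesis
    using Cp_delta_in_Cp by (auto simp: closure_of_subset_eq[symmetric])
qed

text \<open>Continuous functions separate points from closed sets in a Tychonoff space. A function
  that is 0 at \<open>x\<close> and 1 off \<open>V\<close> therefore cuts out, by the condition
  \<open>w f < 1\<close>, a neighbourhood of the evaluation at \<open>x\<close> inside the image of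
  \<open>V\<close>.\<close>

lemma embedding_map_Cp_delta:
  assumes X: "tychonoff_space X"
  shows "embedding_map X (Cp (Cp X)) (Cp_delta X)"
proof -
  let ?D = "Cp_delta X ` topspace X"
  let ?S = "subtopology (Cp (Cp X)) ?D"
  have topS: "topspace ?S = ?D" using Cp_delta_in_Cp by auto
  have contX: "continuous_map X (Cp (Cp X)) (Cp_delta X)"
    by (intro continuous_map_into_Cp Cp_delta_in_Cp) (auto simp: Cp_delta_def topspace_Cp)
  have sep: "\<exists>f\<in>topspace (Cp X). f x = 0 \<and> (\<forall>y\<in>topspace X - V. f y = 1)"
    if "openin X V" "x \<in> V" for V x
    using Cp_unit_separates[OF X that] by (metis IntD1 topspace_Cp_unit)
  have "inj_on (Cp_delta X) (topspace X)"
  proof (rule inj_onI, rule ccontr)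
    fix x y assume xy: "x \<in> topspace X" "y \<in> topspace X" "Cp_delta X x = Cp_delta X y" "x \<noteq> y"
    have "openin X (topspace X - {y})"
      using closedin_tychonoff_finite[OF X, of "{y}"] xy by auto
    then obtain f where f: "f \<in> topspace (Cp X)" "f x = 0" "f y = 1"
      using sep[of "topspace X - {y}" x] xy by blast
    have "f x = f y" using xy(3) f(1) by (metis restrict_apply' Cp_delta_def)
    with f show False by simp
  qed
  moreover have "open_map X ?S (Cp_delta X)"
    unfolding open_map_def
  proof (intro allI impI)
    fix V assume V: "openin X V"
    show "openin ?S (Cp_delta X ` V)"
    proof (subst openin_subopen, intro ballI)
      fix u assume "u \<in> Cp_delta X ` V"
      then obtain x where x: "x \<in> V" "u = Cp_delta X x" by auto
      then have xX: "x \<in> topspace X" using V openin_subset by blast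
      obtain f where f: "f \<in> topspace (Cp X)" "f x = 0" "\<And>y. y \<in> topspace X - V \<Longrightarrow> f y = 1"
        using sep[OF V x(1)] by blast
      let ?W = "{w \<in> topspace ?S. w f \<in> {..<1}}"
      have "openin ?S ?W"
        by (intro openin_continuous_map_preimage[of _ euclideanreal] continuous_map_from_subtopology
            continuous_map_Cp_eval f(1)) simp
      moreover have "u \<in> ?W"
        unfolding topS using x xX f by (auto simp: Cp_delta_def)
      moreover have "?W \<subseteq> Cp_delta X ` V"
        unfolding topS using f by (fastforce simp: Cp_delta_def)
      ultimately show "\<exists>T. openin ?S T \<and> u \<in> T \<and> T \<subseteq> Cp_delta X ` V" by blast
    qed
  qed
  moreover have "continuous_map X ?S (Cp_delta X)"
    using contX by (auto simp: continuous_map_in_subtopology)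
  ultimately show ?thesis
    unfolding embedding_map_def using topS by (intro bijective_open_imp_homeomorphic_map) auto
qed

theorem kR_space_Cp_imp_kappa_space:
  assumes "tychonoff_space X" "kR_space (Cp X)"
  shows "kappa_space X"
proof -
  have "X homeomorphic_space subtopology (Cp (Cp X)) (Cp_delta X ` topspace X)"
    using embedding_map_Cp_delta[OF assms(1)] homeomorphic_map_imp_homeomorphic_space
    unfolding embedding_map_def by blast
  then have "kappa_space_via (Cp X) X"
    using assms(2) tychonoff_space_Cp closedin_Cp_delta by (auto simp: kappa_space_via_def)
  then show ?thesis by (rule kappa_spaceI)
qed

section \<open>Compact sets in spaces with property \<open>(\<kappa>)\<close> are scattered\<close>

text \<open>An open set meeting a crowded \<open>S\<close> contains two points of \<open>S\<close>.
  Hausdorffness separates them and regularity provides closed neighbourhoods inside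
  \<open>U\<close>; each contains an open set meeting \<open>S\<close>, so the splitting can be
  repeated.\<close>

lemma crowded_split:
  assumes Y: "regular_space Y" "Hausdorff_space Y"
    and crowded: "\<And>x U. x \<in> S \<Longrightarrow> openin Y U \<Longrightarrow> U \<inter> S \<noteq> {x}"
    and U: "openin Y U" "U \<inter> S \<noteq> {}"
  obtains E :: "bool \<Rightarrow> 'a set" where "\<And>b. closedin Y (E b)" "\<And>b. E b \<subseteq> U"
    "\<And>b. \<exists>V. openin Y V \<and> V \<subseteq> E b \<and> V \<inter> S \<noteq> {}" "E True \<inter> E False = {}"
proof -
  obtain x where x: "x \<in> U \<inter> S" using U by blast
  then obtain y where y: "y \<in> U \<inter> S" "y \<noteq> x" using crowded[of x U] U by auto
  have "x \<in> topspace Y" "y \<in> topspace Y" using x y U openin_subset by auto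
  then obtain V W where VW: "openin Y V" "openin Y W" "x \<in> V" "y \<in> W" "disjnt V W"
    using Y(2) y(2) unfolding Hausdorff_space_def by metis
  have "\<exists>V' E. openin Y V' \<and> closedin Y E \<and> z \<in> V' \<and> V' \<subseteq> E \<and> E \<subseteq> V"
    if "openin Y V" "z \<in> V" for z V
    using Y(1) that unfolding neighbourhood_base_of_closedin[symmetric] neighbourhood_base_of
    by blast
  from this[of "U \<inter> V" x] this[of "U \<inter> W" y] obtain V' E W' E' where
    "openin Y V'" "closedin Y E" "x \<in> V'" "V' \<subseteq> E" "E \<subseteq> U \<inter> V"
    "openin Y W'" "closedin Y E'" "y \<in> W'" "W' \<subseteq> E'" "E' \<subseteq> U \<inter> W"
    using VW U x y by (auto simp: openin_Int)
  then show thesis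
    using x y VW(5) by (intro that[of "\<lambda>b. if b then E else E'"]) (auto simp: disjnt_iff)
qed

lemma cantor_scheme:
  assumes Y: "compact_space Y" "Hausdorff_space Y"
    and S: "S \<noteq> {}" "S \<subseteq> topspace Y"
    and crowded: "\<And>x U. x \<in> S \<Longrightarrow> openin Y U \<Longrightarrow> U \<inter> S \<noteq> {x}"
  obtains D :: "bool list \<Rightarrow> 'a set" where "\<And>s. closedin Y (D s)" "\<And>s. D s \<noteq> {}"
    "\<And>b s. D (b # s) \<subseteq> D s" "\<And>s. D (True # s) \<inter> D (False # s) = {}"
proof -
  \<comment> \<open>This is the invariant of the recursion: an open set meeting \<open>S\<close>
    inside \<open>C\<close> is what \<open>crowded_split\<close> needs to produce the two
    children.\<close>
  define fat where "fat C \<longleftrightarrow> closedin Y C \<and> (\<exists>V. openin Y V \<and> V \<subseteq> C \<and> V \<inter> S \<noteq> {})" for C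
  have reg: "regular_space Y" using Y by (rule compact_Hausdorff_imp_regular_space)
  have "\<exists>E. fat C \<longrightarrow> (\<forall>b. fat (E b) \<and> E b \<subseteq> C) \<and> E True \<inter> E False = {}" for C
  proof (cases "fat C")
    case True
    then obtain V where V: "openin Y V" "V \<inter> S \<noteq> {}" "V \<subseteq> C" unfolding fat_def by blast
    obtain E :: "bool \<Rightarrow> 'a set" where "\<And>b. closedin Y (E b)" "\<And>b. E b \<subseteq> V"
        "\<And>b. \<exists>V. openin Y V \<and> V \<subseteq> E b \<and> V \<inter> S \<noteq> {}" "E True \<inter> E False = {}"
      using crowded_split[OF reg Y(2) crowded V(1,2)] by blast
    then show ?thesis using V(3) unfolding fat_def by (intro exI[of _ E]) blast
  qed simp
  then obtain E where E: "\<And>C. fat C \<Longrightarrow> (\<forall>b. fat (E C b) \<and> E C b \<subseteq> C) \<and> E C True \<inter> E C False = {}"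
    by metis
  \<comment> \<open>The latest choice stands at the head of the word, so the ancestors of a node are
    the suffixes of its word.\<close>
  define D where "D s = foldr (\<lambda>b C. E C b) s (topspace Y)" for s
  have fat: "fat (D s)" for s
  proof (induction s)
    case Nil
    have "topspace Y \<inter> S \<noteq> {}" using S by blast
    then show ?case unfolding fat_def D_def by auto
  next
    case (Cons b s)
    then show ?case using E by (simp add: D_def)
  qed
  show thesis
  proof (rule that[of D])
    show "closedin Y (D s)" "D s \<noteq> {}" for s using fat[of s] unfolding fat_def by auto
    show "D (b # s) \<subseteq> D s" "D (True # s) \<inter> D (False # s) = {}" for b s
      using E[OF fat[of s]] by (auto simp: D_def)
  qed
qed

lemma cantor_scheme_append:
  assumes "\<And>b s. D (b # s) \<subseteq> D s"
  shows "D (u @ s) \<subseteq> D s"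
  using assms by (induction u) auto

text \<open>A point common to two nodes of one level also lies in their parents. Induction
  identifies the parents, and disjointness of siblings then identifies the last choices.\<close>

lemma cantor_scheme_disjoint:
  fixes D :: "bool list \<Rightarrow> 'a set"
  assumes mono: "\<And>b s. D (b # s) \<subseteq> D s" and "\<And>s. D (True # s) \<inter> D (False # s) = {}"
    and "length s = length t" "x \<in> D s" "x \<in> D t"
  shows "s = t"
  using assms(3-5)
proof (induction s t rule: list_induct2)
  case (Cons b s c t)
  then have "s = t" using mono by blast
  then show ?case using Cons.prems assms(2)[of s] by (cases b; cases c) auto
qed simp

text \<open>Minimality of the closed set \<open>E []\<close> among those meeting all members of the scheme, obtained
  from Zorn's lemma, makes the scheme a countable \<open>\<pi>\<close>-base of it.\<close>

lemma crowded_imp_pi_base: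
  assumes Y: "compact_space Y" "Hausdorff_space Y"
    and S: "S \<noteq> {}" "S \<subseteq> topspace Y"
    and crowded: "\<And>x U. x \<in> S \<Longrightarrow> openin Y U \<Longrightarrow> U \<inter> S \<noteq> {x}"
  obtains E :: "bool list \<Rightarrow> 'a set" where "\<And>s. closedin Y (E s)" "\<And>s. E s \<noteq> {}"
    "\<And>s. E s = E (True # s) \<union> E (False # s)" "\<And>s. E (True # s) \<inter> E (False # s) = {}"
    "\<And>V. openin Y V \<Longrightarrow> V \<inter> E [] \<noteq> {} \<Longrightarrow> \<exists>s. E s \<subseteq> V"
proof -
  obtain D :: "bool list \<Rightarrow> 'a set" where
    cl: "\<And>s. closedin Y (D s)" and ne: "\<And>s. D s \<noteq> {}" and
    mono: "\<And>b s. D (b # s) \<subseteq> D s" and disj: "\<And>s. D (True # s) \<inter> D (False # s) = {}"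
    using cantor_scheme[OF Y S crowded] by blast
  \<comment> \<open>\<open>C\<close> keeps the points that occur on every level. Intersecting with
    it makes each node the union of its two children, which the scheme \<open>D\<close> alone does
    not provide.\<close>
  define C where "C = (\<Inter>n. \<Union>s\<in>{s. length s = n}. D s)"
  define G where "G s = D s \<inter> C" for s
  have finlen: "finite {s :: bool list. length s = n}" for n
    using finite_lists_length_eq[of "UNIV :: bool set" n] by simp
  have "closedin Y (\<Union>s\<in>{s. length s = n}. D s)" for n
    using finlen[of n] cl by (intro closedin_Union) auto
  then have clC: "closedin Y C" unfolding C_def by (intro closedin_Inter) auto
  have clG: "closedin Y (G s)" for s
    unfolding G_def using cl clC by blast
  have neG: "G s \<noteq> {}" for s
  proof -
    \<comment> \<open>A point common to this branch above \<open>s\<close> lies in \<open>C\<close>: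
      dropping the first \<open>length s\<close> letters of the word with \<open>n\<close> added
      letters leaves a suffix of length \<open>n\<close>, whose node contains the point.\<close>
    let ?D = "\<lambda>n. D (replicate n True @ s)"
    have "(\<Inter>n. ?D n) \<noteq> {}"
    proof (rule compact_space_imp_nest[OF Y(1) cl ne])
      show "decseq ?D" by (intro decseq_SucI) (simp add: mono)
    qed
    then obtain x where x: "\<And>n. x \<in> ?D n" by blast
    have "\<exists>t. length t = n \<and> x \<in> D t" for n
    proof (intro exI conjI)
      let ?u = "replicate n True @ s"
      show "length (drop (length s) ?u) = n" by simp
      have "D (take (length s) ?u @ drop (length s) ?u) \<subseteq> D (drop (length s) ?u)"
        by (rule cantor_scheme_append[OF mono])
      then show "x \<in> D (drop (length s) ?u)"
        using x[of n] by (simp only: append_take_drop_id) blast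
    qed
    then have "x \<in> C" unfolding C_def by blast
    moreover have "x \<in> D s" using x[of 0] by simp
    ultimately show ?thesis unfolding G_def by blast
  qed
  have splitG: "G s = G (True # s) \<union> G (False # s)" for s
  proof
    show "G s \<subseteq> G (True # s) \<union> G (False # s)"
    proof
      fix x assume x: "x \<in> G s"
      then obtain t where t: "length t = Suc (length s)" "x \<in> D t"
        unfolding G_def C_def by blast
      then obtain b t' where bt: "t = b # t'" "length t' = length s" by (cases t) auto
      have "t' = s"
        using cantor_scheme_disjoint[OF mono disj bt(2), of x] t(2) x mono bt(1)
        unfolding G_def by blast
      then show "x \<in> G (True # s) \<union> G (False # s)"
        using x t(2) bt(1) unfolding G_def by (cases b) auto
    qed
  qed (use mono in \<open>auto simp: G_def\<close>)
  \<comment> \<open>These are the complements of the closed sets meeting every \<open>G s\<close>,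
    so a maximal member corresponds to a minimal such closed set. Compactness of \<open>G s\<close>
    makes the family closed under unions of nonempty chains: a cover of \<open>G s\<close> by a
    chain reduces to a single member.\<close>
  define \<A> where "\<A> = {U. openin Y U \<and> (\<forall>s. \<not> G s \<subseteq> U)}"
  have "\<exists>M\<in>\<A>. \<forall>U\<in>\<A>. M \<subseteq> U \<longrightarrow> U = M"
  proof (rule subset_Zorn_nonempty)
    show "\<A> \<noteq> {}" unfolding \<A>_def using neG by blast
    fix \<C> assume ne\<C>: "\<C> \<noteq> {}" and ch: "subset.chain \<A> \<C>"
    have \<C>: "\<C> \<subseteq> \<A>" using ch by (simp add: subset_chain_def)
    have "\<not> G s \<subseteq> \<Union>\<C>" for s
    proof
      assume "G s \<subseteq> \<Union>\<C>"
      then obtain \<F> where F: "finite \<F>" "\<F> \<subseteq> \<C>" "G s \<subseteq> \<Union>\<F>"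
        using compactinD[OF closedin_compact_space[OF Y(1) clG[of s]], of \<C>] \<C> unfolding \<A>_def by blast
      then have "\<F> \<noteq> {}" using neG by auto
      moreover have "subset.chain \<A> \<F>"
        using ch F(2) unfolding subset_chain_def by (metis (no_types) subset_trans subsetD)
      ultimately have "\<Union>\<F> \<in> \<C>"
        using Union_in_chain F(1,2) by blast
      with F(3) \<C> show False unfolding \<A>_def by blast
    qed
    then show "\<Union>\<C> \<in> \<A>" using \<C> unfolding \<A>_def by blast
  qed
  then obtain M where "M \<in> \<A>" and max: "\<And>U. U \<in> \<A> \<Longrightarrow> M \<subseteq> U \<Longrightarrow> U = M"
    by metis
  then have M: "openin Y M" "\<And>s. \<not> G s \<subseteq> M" unfolding \<A>_def by simp_all
  show thesis
  proof (rule that[of "\<lambda>s. G s - M"])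
    fix V assume V: "openin Y V" "V \<inter> (G [] - M) \<noteq> {}"
    \<comment> \<open>Maximality of \<open>M\<close> excludes the strictly larger open set
      \<open>M\<close> \<union> \<open>V\<close> from the family, so this set contains some
      \<open>G s\<close>, and then \<open>G s - M\<close> lies in \<open>V\<close>.\<close>
    have "M \<union> V \<noteq> M" using V(2) by auto
    then have "\<exists>s. G s \<subseteq> M \<union> V" using max[of "M \<union> V"] M(1) V(1) unfolding \<A>_def by auto
    then show "\<exists>s. G s - M \<subseteq> V" by blast
  next
    show "closedin Y (G s - M)" for s using clG M(1) by blast
    show "G s - M = (G (True # s) - M) \<union> (G (False # s) - M)" for s
      using splitG[of s] by blast
    show "(G (True # s) - M) \<inter> (G (False # s) - M) = {}" for s
      using disj[of s] unfolding G_def by blast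
  qed (use M(2) in blast)
qed

theorem property_kappa_compactin_scattered:
  assumes kap: "property_kappa X" and haus: "Hausdorff_space X" and K: "compactin X K"
  shows "scattered_space (subtopology X K)"
proof (rule ccontr)
  let ?Y = "subtopology X K"
  assume "\<not> scattered_space ?Y"
  then obtain S where S: "S \<noteq> {}" "S \<subseteq> topspace ?Y"
      and "\<not> (\<exists>x\<in>S. \<exists>U. openin ?Y U \<and> U \<inter> S = {x})"
    by (auto simp only: scattered_space_def not_all not_imp)
  then have crowded: "U \<inter> S \<noteq> {x}" if "x \<in> S" "openin ?Y U" for x U
    using that by metis
  have Y: "compact_space ?Y" "Hausdorff_space ?Y"
    using K haus by (auto simp: compact_space_subtopology Hausdorff_space_subtopology)
  obtain E :: "bool list \<Rightarrow> 'a set" where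
    cl: "\<And>s. closedin ?Y (E s)" and ne: "\<And>s. E s \<noteq> {}" and
    split: "\<And>s. E s = E (True # s) \<union> E (False # s)" and
    disj: "\<And>s. E (True # s) \<inter> E (False # s) = {}" and
    pib: "\<And>V. openin ?Y V \<Longrightarrow> V \<inter> E [] \<noteq> {} \<Longrightarrow> \<exists>s. E s \<subseteq> V"
    using crowded_imp_pi_base[OF Y S crowded] by blast
  have mono: "E (b # s) \<subseteq> E s" for b s using split[of s] by (cases b) auto
  have sub0: "E s \<subseteq> E []" for s using cantor_scheme_append[OF mono, of s "[]"] by simp
  have KX: "E s \<subseteq> topspace X" for s using closedin_subset[OF cl[of s]] by auto
  \<comment> \<open>A finite node would have a nonempty proper subnode, giving an infinite descent
    in cardinality.\<close>
  have inf: "infinite (E s)" for s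
  proof
    show "finite (E s) \<Longrightarrow> False"
    proof (induction "card (E s)" arbitrary: s rule: less_induct)
      case less
      have "E (True # s) \<subset> E s" using split[of s] disj[of s] ne[of "False # s"] by blast
      with less show False by (meson psubset_card_mono finite_subset psubset_imp_subset)
    qed
  qed
  \<comment> \<open>Removing the closed sibling shows inductively that each node is relatively open
    in \<open>E []\<close>. This lets the \<pi>-base be applied inside any given node.\<close>
  have rel_open: "\<exists>V. openin ?Y V \<and> V \<inter> E [] = E s" for s
  proof (induction s)
    case Nil
    show ?case
      using closedin_subset[OF cl[of "[]"]] by (intro exI[of _ "topspace ?Y"] conjI openin_topspace) auto
  next
    case (Cons b s)
    then obtain V where V: "openin ?Y V" "V \<inter> E [] = E s" by blast
    have "openin ?Y (V - E ((\<not> b) # s))" using V(1) cl by blast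
    moreover have "E (b # s) = E s - E ((\<not> b) # s)"
      using split[of s] disj[of s] by (cases b) auto
    ultimately show ?case using V(2) by (intro exI[of _ "V - E ((\<not> b) # s)"]) blast
  qed
  have finlen: "finite {s :: bool list. length s = n}" for n
    using finite_lists_length_eq[of "UNIV :: bool set" n] by simp
  \<comment> \<open>Stage \<open>n\<close> adds a new point in each node of level \<open>n\<close>;
    infinite nodes always have one left. The increments \<open>A n\<close> are thus finite and
    disjoint, and \<open>A n\<close> meets every node of level \<open>n\<close>.\<close>
  have "\<exists>B. \<forall>n. (finite (B n) \<and> B n \<subseteq> E []) \<and>
      (B n \<subseteq> B (Suc n) \<and> (\<forall>s. length s = n \<longrightarrow> (B (Suc n) - B n) \<inter> E s \<noteq> {}))"
  proof (rule dependent_nat_choice)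
    fix B and n :: nat assume B: "finite B \<and> B \<subseteq> E []"
    have "\<exists>y. y \<in> E s - B" for s
      using inf[of s] B by (metis Diff_eq_empty_iff all_not_in_conv finite_subset)
    then obtain y where y: "\<And>s. y s \<in> E s - B" by metis
    show "\<exists>B'. (finite B' \<and> B' \<subseteq> E []) \<and> B \<subseteq> B' \<and> (\<forall>s. length s = n \<longrightarrow> (B' - B) \<inter> E s \<noteq> {})"
      using B y finlen sub0 by (intro exI[of _ "B \<union> y ` {s. length s = n}"]) blast
  qed blast
  then obtain B where B: "\<And>n. finite (B n)" "\<And>n. B n \<subseteq> E []" "\<And>n. B n \<subseteq> B (Suc n)"
      "\<And>n s. length s = n \<Longrightarrow> (B (Suc n) - B n) \<inter> E s \<noteq> {}"
    by blast
  define A where "A n = B (Suc n) - B n" for n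
  have "disjoint_family A" unfolding A_def[abs_def] using B(3) by (rule disjoint_family_Suc)
  moreover have A: "finite (A n)" "A n \<subseteq> E []" for n using B unfolding A_def by blast+
  ultimately obtain r :: "nat \<Rightarrow> nat" where r: "strict_mono r" "strongly_point_finite X UNIV (A \<circ> r)"
    using kap KX unfolding property_kappa_def by (metis subset_trans)
  then obtain U where U: "\<And>i. openin X (U i)" "\<And>i. A (r i) \<subseteq> U i"
      "\<And>x. x \<in> topspace X \<Longrightarrow> finite {i. x \<in> U i}"
    unfolding strongly_point_finite_def by auto
  have "\<exists>i\<ge>m. \<exists>t. E t \<subseteq> E s \<inter> U i" for s and m :: nat
  proof -
    \<comment> \<open>Since \<open>r i\<close> is at least \<open>i\<close>, level
      \<open>r i\<close> lies at or below the level of \<open>s\<close>. Hence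
      \<open>A (r i)\<close>, and with it \<open>U i\<close>, meets a descendant of
      \<open>s\<close>.\<close>
    define i where "i = max m (length s)"
    have "length s \<le> r i" using strict_mono_imp_increasing[OF r(1), of i] by (simp add: i_def)
    then have "A (r i) \<inter> E (replicate (r i - length s) True @ s) \<noteq> {}"
      unfolding A_def by (intro B(4)) simp
    then have meets: "U i \<inter> E s \<noteq> {}"
      using U(2)[of i] cantor_scheme_append[OF mono, of "replicate (r i - length s) True" s] by blast
    obtain V where V: "openin ?Y V" "V \<inter> E [] = E s" using rel_open by blast
    have "openin ?Y (V \<inter> (U i \<inter> K))"
      using V(1) U(1) by (intro openin_Int openin_subtopology_Int)
    moreover have "V \<inter> (U i \<inter> K) \<inter> E [] \<noteq> {}"
      using meets V(2) closedin_subset[OF cl[of s]] by auto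
    ultimately obtain t where "E t \<subseteq> V \<inter> (U i \<inter> K)" using pib by blast
    then show ?thesis using V(2) sub0[of t] by (intro exI[of _ i]) (auto simp: i_def)
  qed
  \<comment> \<open>As in the Baire category theorem, nodes are shrunk successively into sets
    \<open>U i\<close> with ever larger \<open>i\<close>. By compactness they have a common point,
    which lies in infinitely many \<open>U i\<close>. The conjunct \<open>True\<close> is the
    trivial invariant of the choice principle.\<close>
  then have "\<exists>s. \<forall>n :: nat. True \<and> (\<exists>i\<ge>n. E (s (Suc n)) \<subseteq> E (s n) \<inter> U i)"
    by (intro dependent_nat_choice) blast+
  then obtain s where s: "\<And>n :: nat. \<exists>i\<ge>n. E (s (Suc n)) \<subseteq> E (s n) \<inter> U i" by blast
  have "(\<Inter>n. E (s n)) \<noteq> {}"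
  proof (rule compact_space_imp_nest[OF Y(1) cl ne])
    show "decseq (\<lambda>n. E (s n))" by (intro decseq_SucI) (use s in blast)
  qed
  then obtain x where x: "\<And>n. x \<in> E (s n)" by blast
  have "\<exists>i\<ge>n. i \<in> {i. x \<in> U i}" for n using s[of n] x[of "Suc n"] by blast
  then have "infinite {i. x \<in> U i}" by (simp add: infinite_nat_iff_unbounded_le)
  with U(3)[of x] x[of 0] KX show False by blast
qed

section \<open>Universal \<open>\<kappa>\<close>-measure zero\<close>

text \<open>The map \<open>r\<close> sends compact sets to compact sets, so \<open>g\<close> \<circ>
  \<open>r\<close> is k-continuous and hence continuous on \<open>Z\<close>; composing with the
  section \<open>s\<close> recovers \<open>g\<close>.\<close>

lemma kR_space_retraction:
  assumes kR: "kR_space Z" and r: "continuous_map Z Z' r" and s: "continuous_map Z' Z s"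
    and rs: "\<And>z. z \<in> topspace Z' \<Longrightarrow> r (s z) = z"
  shows "kR_space Z'"
  unfolding kR_space_def
proof (intro allI impI)
  fix g assume g: "k_continuous Z' g"
  have "k_continuous Z (g \<circ> r)"
    unfolding k_continuous_def
  proof (intro allI impI)
    fix K assume K: "compactin Z K"
    have "continuous_map (subtopology Z' (r ` K)) euclideanreal g"
      using g image_compactin[OF K r] by (simp add: k_continuous_def)
    moreover have "continuous_map (subtopology Z K) (subtopology Z' (r ` K)) r"
      using r by (auto simp: continuous_map_in_subtopology continuous_map_from_subtopology)
    ultimately show "continuous_map (subtopology Z K) euclideanreal (g \<circ> r)"
      by (blast intro: continuous_map_compose)
  qed
  then have "continuous_map Z euclideanreal (g \<circ> r)"
    using kR by (simp add: kR_space_def)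
  from continuous_map_compose[OF s this] show "continuous_map Z' euclideanreal g"
    by (rule continuous_map_eq) (simp add: rs)
qed

lemma kR_space_Cp_unit:
  assumes "kR_space (Cp X)"
  shows "kR_space (Cp_unit X)"
proof (rule kR_space_retraction[OF assms])
  let ?r = "\<lambda>f. \<lambda>x\<in>topspace X. max (- 1) (min 1 (f x :: real))"
  have "continuous_map (Cp X) (Cp X) ?r"
  proof (rule continuous_map_into_Cp)
    show "?r f \<in> topspace (Cp X)" if "f \<in> topspace (Cp X)" for f
      using that unfolding topspace_Cp
      by (intro restrict_in_topspace_Cp[unfolded topspace_Cp] continuous_map_real_max
          continuous_map_real_min continuous_map_canonical_const) auto
    show "continuous_map (Cp X) euclideanreal (\<lambda>f. ?r f x)" if "x \<in> topspace X" for x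
      using that by (simp add: continuous_map_real_max continuous_map_real_min continuous_map_Cp_eval)
  qed
  then show "continuous_map (Cp X) (Cp_unit X) ?r"
    by (auto simp: Cp_unit_def continuous_map_in_subtopology)
  show "continuous_map (Cp_unit X) (Cp X) id"
    by (simp add: Cp_unit_def continuous_map_from_subtopology)
  show "?r (id f) = f" if "f \<in> topspace (Cp_unit X)" for f
    using that by (intro extensionalityI[of _ "topspace X"]) (auto simp: topspace_Cp_unit topspace_Cp image_subset_iff)
qed

lemma continuous_map_Cp_unit_eval:
  "x \<in> topspace X \<Longrightarrow> continuous_map (Cp_unit X) euclideanreal (\<lambda>f. f x)"
  unfolding Cp_unit_def by (intro continuous_map_from_subtopology continuous_map_Cp_eval)

lemma Cp_unit_open_finite_support:
  assumes "openin (Cp_unit X) W" "f \<in> W"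
  obtains F where "finite F" "F \<subseteq> topspace X"
    "\<forall>g\<in>topspace (Cp_unit X). (\<forall>x\<in>F. g x = f x) \<longrightarrow> g \<in> W"
proof -
  obtain T where T: "openin (Cp X) T" "W = T \<inter> {f. f ` topspace X \<subseteq> {-1..1}}"
    using assms(1) unfolding Cp_unit_def openin_subtopology by blast
  have fT: "f \<in> T" using assms(2) T(2) by blast
  obtain F where "finite F" "F \<subseteq> topspace X"
    "\<forall>g\<in>topspace (Cp X). (\<forall>x\<in>F. g x = f x) \<longrightarrow> g \<in> T"
    by (rule Cp_open_finite_support[OF T(1) fT])
  then show thesis
    using T(2) by (intro that[of F]) (auto simp: topspace_Cp_unit)
qed

section \<open>Measurability and integration for regular Borel probability measures\<close>

lemma regular_borel_probD:
  assumes "\<mu> \<in> regular_borel_prob K"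
  shows "space \<mu> = topspace K" "sets \<mu> = sigma_sets (topspace K) {U. openin K U}"
    "emeasure \<mu> (space \<mu>) = 1"
    "B \<in> sets \<mu> \<Longrightarrow>
       emeasure \<mu> B = (SUP C\<in>{C. compactin K C \<and> C \<in> sets \<mu> \<and> C \<subseteq> B}. emeasure \<mu> C)"
  using assms unfolding regular_borel_prob_def by blast+

lemma regular_borel_prob_closed_sets:
  assumes "\<mu> \<in> regular_borel_prob K" "closedin K C"
  shows "C \<in> sets \<mu>"
proof -
  have "topspace K - (topspace K - C) \<in> sigma_sets (topspace K) {U. openin K U}"
    using assms(2) by (intro sigma_sets.Compl sigma_sets.Basic) (auto simp: closedin_def)
  moreover have "topspace K - (topspace K - C) = C"
    using closedin_subset[OF assms(2)] by blast
  ultimately show ?thesis using regular_borel_probD(2)[OF assms(1)] by simp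
qed

lemma regular_borel_prob_borel_measurable:
  fixes g :: "'a \<Rightarrow> real"
  assumes \<mu>: "\<mu> \<in> regular_borel_prob K" and g: "continuous_map K euclideanreal g"
  shows "g \<in> borel_measurable \<mu>"
proof (rule borel_measurableI)
  fix S :: "real set" assume "open S"
  then have "openin K {x \<in> topspace K. g x \<in> S}"
    using openin_continuous_map_preimage[OF g, of S] by simp
  moreover have "{x \<in> topspace K. g x \<in> S} = g -` S \<inter> space \<mu>"
    using regular_borel_probD(1)[OF \<mu>] by auto
  ultimately show "g -` S \<inter> space \<mu> \<in> sets \<mu>"
    using regular_borel_probD(2)[OF \<mu>] by auto
qed

lemma regular_borel_prob_finite_sets:
  assumes "\<mu> \<in> regular_borel_prob K" "Hausdorff_space K" "finite V" "V \<subseteq> topspace K"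
  shows "V \<in> sets \<mu>"
  using assms by (intro regular_borel_prob_closed_sets[OF assms(1)])
    (simp add: closedin_Hausdorff_finite)

lemma regular_borel_prob_countable_sets:
  assumes "\<mu> \<in> regular_borel_prob K" "Hausdorff_space K" "countable V" "V \<subseteq> topspace K"
  shows "V \<in> sets \<mu>"
proof -
  have "(\<Union>v\<in>V. {v}) \<in> sets \<mu>"
    using assms by (intro sets.countable_UN') (auto intro!: regular_borel_prob_finite_sets)
  then show ?thesis by simp
qed

text \<open>The difference is the integral of \<open>g\<close> over the complement of
  \<open>V\<close>, where \<open>g\<close> is bounded by 1. The bound is independent of
  \<open>g\<close>, which later gives uniform approximation.\<close>

lemma (in finite_measure) integral_approx_finite:
  fixes g :: "'a \<Rightarrow> real"
  assumes g: "g \<in> borel_measurable M" "\<And>x. x \<in> space M \<Longrightarrow> \<bar>g x\<bar> \<le> 1"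
    and V: "finite V" "\<And>v. v \<in> V \<Longrightarrow> {v} \<in> sets M"
  shows "\<bar>(\<integral>x. g x \<partial>M) - (\<Sum>v\<in>V. measure M {v} * g v)\<bar> \<le> measure M (space M - V)"
proof -
  have "(\<Union>v\<in>V. {v}) \<in> sets M" using V by (intro sets.finite_UN) auto
  then have VM: "V \<in> sets M" by simp
  have int_g: "integrable M g"
    using g by (intro integrable_const_bound[of _ 1]) auto
  have int_v: "integrable M (\<lambda>x. indicator {v} x * g v)" if "v \<in> V" for v
    using V(2)[OF that] by (intro integrable_mult_left) (simp add: integrable_indicator_iff emeasure_eq_measure)
  have "(\<integral>x. (\<Sum>v\<in>V. indicator {v} x * g v) \<partial>M) = (\<Sum>v\<in>V. \<integral>x. indicator {v} x * g v \<partial>M)"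
    using int_v by (rule Bochner_Integration.integral_sum)
  also have "\<dots> = (\<Sum>v\<in>V. measure M {v} * g v)"
  proof (rule sum.cong[OF refl])
    fix v assume "v \<in> V"
    then have "{v} \<inter> space M = {v}" using sets.sets_into_space[OF V(2)] by blast
    then show "(\<integral>x. indicator {v} x * g v \<partial>M) = measure M {v} * g v" by simp
  qed
  finally have "(\<integral>x. g x \<partial>M) - (\<Sum>v\<in>V. measure M {v} * g v)
      = (\<integral>x. g x \<partial>M) - (\<integral>x. (\<Sum>v\<in>V. indicator {v} x * g v) \<partial>M)"
    by simp
  also have "\<dots> = (\<integral>x. g x - (\<Sum>v\<in>V. indicator {v} x * g v) \<partial>M)"
    using int_g int_v by simp
  also have "\<dots> = (\<integral>x. indicator (space M - V) x * g x \<partial>M)"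
  proof (rule Bochner_Integration.integral_cong[OF refl])
    fix x assume x: "x \<in> space M"
    have "(\<Sum>v\<in>V. indicator {v} x * g v) = (\<Sum>v\<in>V. if v = x then g x else 0)"
      by (intro sum.cong) auto
    then show "g x - (\<Sum>v\<in>V. indicator {v} x * g v) = indicator (space M - V) x * g x"
      using V(1) x by (simp add: indicator_def)
  qed
  also have "\<bar>\<dots>\<bar> \<le> (\<integral>x. indicator (space M - V) x \<partial>M)"
  proof (rule order_trans[OF integral_abs_bound], rule integral_mono')
    show "integrable M (indicator (space M - V) :: 'a \<Rightarrow> real)"
      using VM by (simp add: integrable_indicator_iff emeasure_eq_measure)
  qed (use g(2) in \<open>auto simp: indicator_def\<close>)
  also have "\<dots> = measure M (space M - V)" by (simp add: Int_absorb2)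
  finally show ?thesis .
qed

section \<open>Restriction to the space and extension to its Stone-Cech compactification\<close>

lemma sc_extend_sc_embed:
  assumes "f \<in> topspace (Cp_unit X)" "x \<in> topspace X"
  shows "sc_extend X f (sc_embed X x) = f x"
  using assms by (simp add: sc_extend_eq sc_embed_in_stone_cech) (simp add: sc_embed_def)

lemma continuous_map_sc_extend:
  assumes "f \<in> topspace (Cp_unit X)"
  shows "continuous_map (stone_cech X) (top_of_set {-1..1}) (sc_extend X f)"
proof -
  have "continuous_map (product_topology (\<lambda>_. top_of_set {-1..1::real}) (topspace (Cp_unit X)))
      (top_of_set {-1..1}) (\<lambda>u. u f)"
    using assms by (rule continuous_map_product_projection)
  then have "continuous_map (stone_cech X) (top_of_set {-1..1}) (\<lambda>u. u f)"
    unfolding stone_cech_def Let_def by (rule continuous_map_from_subtopology)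
  then show ?thesis
    by (rule continuous_map_eq) (simp add: sc_extend_eq[OF assms])
qed

text \<open>By density of the image of \<open>X\<close>, a function on the compactification is
  determined by its restriction. Urysohn functions found on the compactification thus become
  elements of \<open>Cp_unit X\<close> with known integrals.\<close>

lemma sc_extend_restrict:
  assumes g: "continuous_map (stone_cech X) (top_of_set {-1..1}) g"
  defines "f \<equiv> \<lambda>x\<in>topspace X. g (sc_embed X x)"
  shows "f \<in> topspace (Cp_unit X)"
    and "\<And>u. u \<in> topspace (stone_cech X) \<Longrightarrow> sc_extend X f u = g u"
proof -
  have gr: "continuous_map (stone_cech X) euclideanreal g"
    using g by (rule continuous_map_into_fulltopology)
  have "continuous_map X euclideanreal (\<lambda>x. g (sc_embed X x))"
    using continuous_map_compose[OF continuous_map_sc_embed gr] by (simp add: o_def)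
  then have "f \<in> topspace (Cp X)"
    unfolding f_def by (rule restrict_in_topspace_Cp)
  moreover have "f ` topspace X \<subseteq> {-1..1}"
    using continuous_map_image_subset_topspace[OF g] sc_embed_in_stone_cech[of _ X]
    by (auto simp: f_def image_subset_iff)
  ultimately show f: "f \<in> topspace (Cp_unit X)" by (simp add: topspace_Cp_unit)
  fix u assume "u \<in> topspace (stone_cech X)"
  then have u: "u \<in> stone_cech X closure_of (sc_embed X ` topspace X)"
    by (simp only: stone_cech_dense)
  have c: "continuous_map (stone_cech X) euclideanreal (sc_extend X f)"
    using continuous_map_sc_extend[OF f] by (rule continuous_map_into_fulltopology)
  show "sc_extend X f u = g u"
  proof (rule forall_in_closure_of_eq[OF u _ c gr])
    fix w assume "w \<in> sc_embed X ` topspace X"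
    then obtain x where x: "x \<in> topspace X" "w = sc_embed X x" by blast
    then show "sc_extend X f w = g w"
      using sc_extend_sc_embed[OF f x(1)] by (simp add: f_def)
  qed simp
qed

section \<open>Comparison of discrete and k-continuous measures\<close>

lemma regular_borel_prob_finite_measure:
  "\<mu> \<in> regular_borel_prob K \<Longrightarrow> finite_measure \<mu>"
  by (rule finite_measureI) (simp add: regular_borel_probD(3))

text \<open>Exhausting the countable carrier by finite sets makes the functional a uniform limit of
  finite combinations of point evaluations, hence continuous on all of
  \<open>Cp_unit X\<close>.\<close>

lemma P_discrete_subset_P_kappa: "P_discrete X \<subseteq> P_kappa X"
proof
  fix \<mu> assume "\<mu> \<in> P_discrete X"
  then obtain A where \<mu>: "\<mu> \<in> regular_borel_prob (stone_cech X)"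
    and A: "countable A" "A \<subseteq> topspace X" "emeasure \<mu> (sc_embed X ` A) = 1"
    unfolding P_discrete_def by blast
  interpret finite_measure \<mu> using \<mu> by (rule regular_borel_prob_finite_measure)
  have total: "measure \<mu> (space \<mu>) = 1"
    by (simp add: measure_def regular_borel_probD(3)[OF \<mu>])
  have space: "space \<mu> = topspace (stone_cech X)" using \<mu> by (rule regular_borel_probD)
  have AX: "sc_embed X ` B \<subseteq> topspace (stone_cech X)" if "B \<subseteq> A" for B
    using sc_embed_in_stone_cech[of _ X] A(2) that by blast
  have "A \<noteq> {}" using A(3) by auto
  \<comment> \<open>The enumeration may repeat elements, which covers finite and infinite
    \<open>A\<close> alike.\<close>
  define F where "F n = from_nat_into A ` {..<n}" for n
  have F: "finite (F n)" "F n \<subseteq> A" for n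
    using from_nat_into[OF \<open>A \<noteq> {}\<close>] by (auto simp: F_def)
  define V where "V n = sc_embed X ` F n" for n
  have V: "finite (V n)" "V n \<subseteq> topspace (stone_cech X)" "V n \<in> sets \<mu>" for n
    using F[of n] AX regular_borel_prob_finite_sets[OF \<mu> Hausdorff_space_stone_cech]
    by (auto simp: V_def)
  have sing: "{v} \<in> sets \<mu>" if "v \<in> V n" for v n
    using that V regular_borel_prob_finite_sets[OF \<mu> Hausdorff_space_stone_cech, of "{v}"] by blast
  have "(\<Union>n. F n) = A"
    using F(2) from_nat_into_surj[OF A(1)] unfolding F_def by (fastforce simp: image_iff)
  then have UN: "(\<Union>n. V n) = sc_embed X ` A" unfolding V_def by blast
  have "(\<lambda>n. measure \<mu> (V n)) \<longlonglongrightarrow> measure \<mu> (\<Union>n. V n)"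
    using V(3) by (intro finite_Lim_measure_incseq) (auto simp: V_def F_def incseq_def)
  then have "(\<lambda>n. 1 - measure \<mu> (V n)) \<longlonglongrightarrow> 1 - 1"
    using A(3) UN by (intro tendsto_intros) (simp add: measure_def)
  then have lim: "(\<lambda>n. measure \<mu> (space \<mu> - V n)) \<longlonglongrightarrow> 0"
    using V(3) by (simp add: finite_measure_compl total)
  define S where "S n f = (\<Sum>v\<in>V n. measure \<mu> {v} * sc_extend X f v)" for n f
  have contS: "continuous_map (Cp_unit X) euclideanreal (S n)" for n
  proof -
    have "continuous_map (Cp_unit X) euclideanreal (\<lambda>f. sc_extend X f v)" if "v \<in> V n" for v
    proof -
      obtain x where x: "x \<in> topspace X" "v = sc_embed X x"
        using \<open>v \<in> V n\<close> F(2) A(2) unfolding V_def by blast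
      from continuous_map_Cp_unit_eval[OF x(1)] show ?thesis
        by (rule continuous_map_eq) (simp add: sc_extend_sc_embed x)
    qed
    then show ?thesis
      unfolding S_def[abs_def] using V(1)
      by (intro continuous_map_sum continuous_map_real_mult continuous_map_canonical_const)
  qed
  have approx: "\<bar>(\<integral>u. sc_extend X f u \<partial>\<mu>) - S n f\<bar> \<le> measure \<mu> (space \<mu> - V n)"
    if f: "f \<in> topspace (Cp_unit X)" for f n
    unfolding S_def
  proof (rule integral_approx_finite)
    have c: "continuous_map (stone_cech X) (top_of_set {-1..1}) (sc_extend X f)"
      using f by (rule continuous_map_sc_extend)
    then show "sc_extend X f \<in> borel_measurable \<mu>"
      using \<mu> by (intro regular_borel_prob_borel_measurable) (auto dest: continuous_map_into_fulltopology)
    show "\<bar>sc_extend X f u\<bar> \<le> 1" if "u \<in> space \<mu>" for u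
      using continuous_map_image_subset_topspace[OF c] that space by (force simp: abs_le_iff)
  qed (use V sing in auto)
  have "continuous_map (Cp_unit X) Met_TC.mtopology (\<lambda>f. \<integral>u. sc_extend X f u \<partial>\<mu>)"
  proof (rule Met_TC.continuous_map_uniform_limit[where f = S and F = sequentially])
    show "\<forall>\<^sub>F n in sequentially. continuous_map (Cp_unit X) Met_TC.mtopology (S n)"
      using contS by simp
    fix \<epsilon> :: real assume "0 < \<epsilon>"
    from order_tendstoD(2)[OF lim this]
    show "\<forall>\<^sub>F n in sequentially. \<forall>f\<in>topspace (Cp_unit X).
        (\<integral>u. sc_extend X f u \<partial>\<mu>) \<in> UNIV \<and> dist (S n f) (\<integral>u. sc_extend X f u \<partial>\<mu>) < \<epsilon>"
    proof (rule eventually_mono, intro ballI conjI UNIV_I)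
      fix n f assume "measure \<mu> (space \<mu> - V n) < \<epsilon>" "f \<in> topspace (Cp_unit X)"
      then show "dist (S n f) (\<integral>u. sc_extend X f u \<partial>\<mu>) < \<epsilon>"
        using approx[of f n] by (simp add: dist_real_def abs_minus_commute)
    qed
  qed simp
  then have "continuous_map (Cp_unit X) euclideanreal (\<lambda>f. \<integral>u. sc_extend X f u \<partial>\<mu>)"
    by simp
  then show "\<mu> \<in> P_kappa X"
    using \<mu> by (auto simp: P_kappa_def k_continuous_def continuous_map_from_subtopology)
qed

text \<open>Continuity at zero gives a finite \<open>F\<close> such that functions vanishing on
  \<open>F\<close> have integral below \<epsilon>. A compact set \<open>C\<close> disjoint from the
  image of \<open>F\<close> carries a Urysohn function that is 1 on \<open>C\<close> and 0 on that
  image, so \<open>C\<close> has measure below \<epsilon>. Inner regularity passes this, as a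
  non-strict bound, to the whole complement.\<close>

lemma continuous_measure_concentrated:
  assumes \<mu>: "\<mu> \<in> regular_borel_prob (stone_cech X)"
    and cont: "continuous_map (Cp_unit X) euclideanreal (\<lambda>f. \<integral>u. sc_extend X f u \<partial>\<mu>)"
    and "0 < \<epsilon>"
  obtains F where "finite F" "F \<subseteq> topspace X"
    "measure \<mu> (space \<mu> - sc_embed X ` F) \<le> \<epsilon>"
proof -
  let ?I = "\<lambda>f. \<integral>u. sc_extend X f u \<partial>\<mu>"
  interpret finite_measure \<mu> using \<mu> by (rule regular_borel_prob_finite_measure)
  have space: "space \<mu> = topspace (stone_cech X)" using \<mu> by (rule regular_borel_probD)
  define z where "z = (\<lambda>x\<in>topspace X. 0::real)"
  have z: "z \<in> topspace (Cp_unit X)" "\<And>u. u \<in> space \<mu> \<Longrightarrow> sc_extend X z u = 0"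
    using sc_extend_restrict[of X "\<lambda>_. 0"] by (simp_all add: z_def space)
  let ?W = "{f \<in> topspace (Cp_unit X). ?I f \<in> {..<\<epsilon>}}"
  have "?I z = (\<integral>u. 0 \<partial>\<mu>)"
    using z(2) by (intro Bochner_Integration.integral_cong) auto
  then have zW: "z \<in> ?W" using z(1) \<open>0 < \<epsilon>\<close> by simp
  have W: "openin (Cp_unit X) ?W"
    using cont by (rule openin_continuous_map_preimage) simp
  obtain F where F: "finite F" "F \<subseteq> topspace X"
      "\<forall>g\<in>topspace (Cp_unit X). (\<forall>x\<in>F. g x = z x) \<longrightarrow> g \<in> ?W"
    by (rule Cp_unit_open_finite_support[OF W zW])
  let ?B = "space \<mu> - sc_embed X ` F"
  have FX: "sc_embed X ` F \<subseteq> topspace (stone_cech X)"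
    using F(2) sc_embed_in_stone_cech[of _ X] by blast
  have FM: "sc_embed X ` F \<in> sets \<mu>"
    using F(1) FX by (intro regular_borel_prob_finite_sets[OF \<mu> Hausdorff_space_stone_cech]) auto
  have "emeasure \<mu> C \<le> ennreal \<epsilon>"
    if C: "compactin (stone_cech X) C" "C \<in> sets \<mu>" "C \<subseteq> ?B" for C
  proof -
    have "completely_regular_space (stone_cech X)"
      using compact_space_stone_cech Hausdorff_space_stone_cech
      by (intro normal_imp_completely_regular_space compact_Hausdorff_or_regular_imp_normal_space) auto
    moreover have "closedin (stone_cech X) (sc_embed X ` F)"
      using closedin_Hausdorff_finite[OF Hausdorff_space_stone_cech FX] F(1) by blast
    moreover have "disjnt C (sc_embed X ` F)" using C(3) by (auto simp: disjnt_def)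
    ultimately obtain g where g: "continuous_map (stone_cech X) (top_of_set {0..1::real}) g"
        "g ` sc_embed X ` F \<subseteq> {0}" "g ` C \<subseteq> {1}"
      using Urysohn_completely_regular_compact_closed[of 0 1 "stone_cech X" C] C(1) by auto
    have g1: "continuous_map (stone_cech X) (top_of_set {-1..1}) g"
      using g(1) by (fastforce simp: continuous_map_in_subtopology Pi_iff)
    have g01: "0 \<le> g u" "g u \<le> 1" if "u \<in> space \<mu>" for u
      using continuous_map_image_subset_topspace[OF g(1)] that space by auto
    let ?f = "\<lambda>x\<in>topspace X. g (sc_embed X x)"
    have "?I ?f < \<epsilon>"
      using bspec[OF F(3) sc_extend_restrict(1)[OF g1]] g(2) F(2)
      by (auto simp: z_def image_subset_iff subset_iff)
    moreover have "?I ?f = (\<integral>u. g u \<partial>\<mu>)"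
      using sc_extend_restrict(2)[OF g1] by (intro Bochner_Integration.integral_cong) (auto simp: space)
    moreover have "measure \<mu> C = (\<integral>u. indicator C u \<partial>\<mu>)"
      using C(2) by (simp add: Int_absorb2 sets.sets_into_space)
    moreover have "\<dots> \<le> (\<integral>u. g u \<partial>\<mu>)"
    proof (rule integral_mono')
      have "g \<in> borel_measurable \<mu>"
        using g(1) by (intro regular_borel_prob_borel_measurable[OF \<mu>]) (rule continuous_map_into_fulltopology)
      then show "integrable \<mu> g"
        using g01 by (intro integrable_const_bound[of _ 1]) auto
    qed (use g01 g(3) in \<open>auto simp: indicator_def\<close>)
    ultimately have "measure \<mu> C \<le> \<epsilon>" by linarith
    then show ?thesis by (simp add: emeasure_eq_measure ennreal_leI)
  qed
  then have "emeasure \<mu> ?B \<le> ennreal \<epsilon>"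
    unfolding regular_borel_probD(4)[OF \<mu> sets.compl_sets[OF FM]] by (intro SUP_least) blast
  then have "measure \<mu> ?B \<le> \<epsilon>"
    using \<open>0 < \<epsilon>\<close> by (simp add: emeasure_eq_measure)
  with F(1,2) show thesis by (rule that)
qed

theorem kR_space_Cp_imp_universal_kappa_measure_zero:
  assumes "kR_space (Cp X)"
  shows "universal_kappa_measure_zero X"
proof -
  have "\<mu> \<in> P_discrete X" if "\<mu> \<in> P_kappa X" for \<mu>
  proof -
    let ?I = "\<lambda>f. \<integral>u. sc_extend X f u \<partial>\<mu>"
    from that have \<mu>: "\<mu> \<in> regular_borel_prob (stone_cech X)"
      and "k_continuous (Cp_unit X) ?I" by (auto simp: P_kappa_def)
    then have cont: "continuous_map (Cp_unit X) euclideanreal ?I"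
      using kR_space_Cp_unit[OF assms] by (simp add: kR_space_def)
    interpret finite_measure \<mu> using \<mu> by (rule regular_borel_prob_finite_measure)
    have total: "measure \<mu> (space \<mu>) = 1"
      by (simp add: measure_def regular_borel_probD(3)[OF \<mu>])
    have "\<exists>F. finite F \<and> F \<subseteq> topspace X \<and> measure \<mu> (space \<mu> - sc_embed X ` F) \<le> inverse (real (Suc n))" for n
      using continuous_measure_concentrated[OF \<mu> cont, of "inverse (real (Suc n))"]
      by (metis inverse_positive_iff_positive of_nat_0_less_iff zero_less_Suc)
    then obtain F where F: "\<And>n. finite (F n)" "\<And>n. F n \<subseteq> topspace X"
        "\<And>n. measure \<mu> (space \<mu> - sc_embed X ` F n) \<le> inverse (real (Suc n))"
      by metis
    \<comment> \<open>The complement of the image of \<open>A\<close> lies in the complement of the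
      image of each \<open>F n\<close>, so its measure is at most \<open>1/(n+1)\<close> for every
      \<open>n\<close>.\<close>
    define A where "A = (\<Union>n. F n)"
    have A: "countable A" "A \<subseteq> topspace X"
      using F unfolding A_def by (auto intro: countable_finite)
    have sets: "sc_embed X ` B \<in> sets \<mu>" if "B \<subseteq> A" for B
    proof (rule regular_borel_prob_countable_sets[OF \<mu> Hausdorff_space_stone_cech])
      show "countable (sc_embed X ` B)" using that A(1) countable_subset by blast
      show "sc_embed X ` B \<subseteq> topspace (stone_cech X)"
        using that A(2) sc_embed_in_stone_cech[of _ X] by blast
    qed
    have "measure \<mu> (space \<mu> - sc_embed X ` A) \<le> inverse (real (Suc n))" for n
      using sets[of "F n"] by (intro order_trans[OF finite_measure_mono F(3)]) (auto simp: A_def)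
    then have "measure \<mu> (space \<mu> - sc_embed X ` A) \<le> 0"
      by (intro LIMSEQ_le_const[OF LIMSEQ_inverse_real_of_nat]) auto
    then have "measure \<mu> (sc_embed X ` A) = 1"
      using sets[of A] by (simp add: finite_measure_compl total) (metis antisym bounded_measure total)
    then show ?thesis
      using \<mu> A by (auto simp: P_discrete_def emeasure_eq_measure)
  qed
  then have "P_kappa X \<subseteq> P_discrete X" by (rule subsetI)
  with P_discrete_subset_P_kappa[of X] show ?thesis
    unfolding universal_kappa_measure_zero_def by (rule subset_antisym[rotated])
qed

theorem proposition11p1:
  fixes X :: "'a topology"
  assumes "tychonoff_space X"
    and "kR_space (Cp X)"
  shows "property_kappa X \<and>
         universal_kappa_measure_zero X \<and>
         kappa_space X \<and>
         (\<forall>K. compactin X K \<longrightarrow> scattered_space (subtopology X K))"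
proof (intro conjI allI impI)
  show "property_kappa X" using assms by (rule kR_space_Cp_imp_property_kappa)
  then show "scattered_space (subtopology X K)" if "compactin X K" for K
    using assms(1) that by (intro property_kappa_compactin_scattered) (auto simp: tychonoff_space_def)
  show "universal_kappa_measure_zero X"
    using assms(2) by (rule kR_space_Cp_imp_universal_kappa_measure_zero)
  show "kappa_space X" using assms by (rule kR_space_Cp_imp_kappa_space)
qed

end
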